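(* Let $\varphi:\mathbb{R}\to\mathbb{R}$ be a smooth function such that $\varphi$ is monotone, $\dddot{\varphi}\,\dot{\varphi}\ge 0$ and $\ddot{\varphi}\le 0$ on $\mathbb{R}$. Let $\Sigma$ be a properly embedded $[\varphi,\vec{e}_3]$-minimal surface in $\mathbb{R}^3$ with bounded mean curvature $H$ and Gauss curvature $K\ge 0$. Suppose that there is a constant $C>0$ such that $$|\dot{\varphi}(\langle p,\vec{e}_3\rangle)|\le C|p|\log|p|\qquad\text{as } p\to\infty\text{ on }\Sigma,$$ and that there are a constant $\varepsilon>0$ and a vector $y_0\in\mathbb{S}^2$ with $\langle y_0,\vec{e}_3\rangle=0$ such that the Gauss map $N:\Sigma\to\mathbb{S}^2$ satisfies $$\langle N,y_0\rangle\le -2\varepsilon\qquad\text{on }\Sigma.$$ Then $\Sigma$ is a plane.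
   Context: $\langle\cdot,\cdot\rangle$ is the Euclidean metric of $\mathbb{R}^3$, $|p|$ is the Euclidean distance from $p$ to the origin, and $\vec{e}_3=(0,0,1)$. A dot denotes the derivative of $\varphi$ with respect to its real variable (the third coordinate); at a point $p$ of a surface, $\varphi$ and its derivatives are evaluated at $\langle p,\vec{e}_3\rangle$. An inequality "as $p\to\infty$ on $\Sigma$" means that it holds for all $p\in\Sigma$ with $|p|$ sufficiently large. Surfaces are smooth, connected, without boundary, and oriented by a unit normal $N:\Sigma\to\mathbb{S}^2$ (the Gauss map). A surface $\Sigma$ in $\mathbb{R}^3$ is $[\varphi,\vec{e}_3]$-minimal if it is a critical point of the weighted area functional $\int_\Sigma e^{\varphi}\,d\Sigma$, where $\varphi$ on $\Sigma$ means $p\mapsto\varphi(\langle p,\vec{e}_3\rangle)$; equivalently, its mean curvature vector $\mathbf{H}$ (the trace of the vector-valued second fundamental form) satisfies $\mathbf{H}=\dot{\varphi}\,\vec{e}_3^{\,\perp}$, where $\perp$ is the projection onto the normal bundle. $H$ is the corresponding scalar mean curvature, i.e. the sum of the principal curvatures (so $|H|=|\mathbf{H}|$), and $K$ is the Gauss curvature. *)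

theory Defs
  imports "HOL-Analysis.Analysis"
begin

(* Class C^k and C^infinity; these are meant for an open set S of a finite-dimensional space,
   where continuity of all iterated directional derivatives amounts to the usual notion. *)

primrec Ck_on :: "nat \<Rightarrow> 'a set \<Rightarrow> ('a::real_normed_vector \<Rightarrow> 'b::real_normed_vector) \<Rightarrow> bool" where
  "Ck_on 0 S f \<longleftrightarrow> continuous_on S f"
| "Ck_on (Suc k) S f \<longleftrightarrow>
     f differentiable_on S \<and> (\<forall>v. Ck_on k S (\<lambda>x. frechet_derivative f (at x) v))"

definition smooth_on :: "'a set \<Rightarrow> ('a::real_normed_vector \<Rightarrow> 'b::real_normed_vector) \<Rightarrow> bool" where
  "smooth_on S f \<longleftrightarrow> (\<forall>k. Ck_on k S f)"

definition local_parametrization ::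
    "(real^3) set \<Rightarrow> (real^2) set \<Rightarrow> (real^2 \<Rightarrow> real^3) \<Rightarrow> bool" where
  "local_parametrization S U X \<longleftrightarrow>
     open U \<and> smooth_on U X \<and> (\<forall>x\<in>U. inj (frechet_derivative X (at x))) \<and>
     openin (top_of_set S) (X ` U) \<and> (\<exists>Y. homeomorphism U (X ` U) X Y)"

definition embedded_surface :: "(real^3) set \<Rightarrow> bool" where
  "embedded_surface S \<longleftrightarrow>
     S \<noteq> {} \<and> connected S \<and> (\<forall>p\<in>S. \<exists>U X. local_parametrization S U X \<and> p \<in> X ` U)"

(* The second conjunct says that the inclusion of S into the ambient space is a proper map. *)

definition properly_embedded_surface :: "(real^3) set \<Rightarrow> bool" where
  "properly_embedded_surface S \<longleftrightarrow>
     embedded_surface S \<and> (\<forall>K. compact K \<longrightarrow> compact (S \<inter> K))"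

definition tangent_plane :: "(real^3) set \<Rightarrow> real^3 \<Rightarrow> (real^3) set" where
  "tangent_plane S p =
     {v. \<exists>(\<gamma> :: real \<Rightarrow> real^3) \<delta>. \<delta> > 0 \<and> smooth_on {-\<delta><..<\<delta>} \<gamma> \<and>
           \<gamma> ` {-\<delta><..<\<delta>} \<subseteq> S \<and> \<gamma> 0 = p \<and> (\<gamma> has_vector_derivative v) (at 0)}"

(* Smoothness of a map defined on a surface: it extends smoothly near each point. *)

definition smooth_on_surface :: "(real^3) set \<Rightarrow> (real^3 \<Rightarrow> real^3) \<Rightarrow> bool" where
  "smooth_on_surface S f \<longleftrightarrow>
     (\<forall>p\<in>S. \<exists>V F. open V \<and> p \<in> V \<and> smooth_on V F \<and> (\<forall>q\<in>S \<inter> V. F q = f q))"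

definition gauss_map :: "(real^3) set \<Rightarrow> (real^3 \<Rightarrow> real^3) \<Rightarrow> bool" where
  "gauss_map S N \<longleftrightarrow>
     smooth_on_surface S N \<and>
     (\<forall>p\<in>S. norm (N p) = 1 \<and> (\<forall>v\<in>tangent_plane S p. N p \<bullet> v = 0))"

(* The derivative of N within S is determined only on the tangent plane at p;
   the shape operator must be applied to tangent vectors only. *)

definition shape_operator ::
    "(real^3) set \<Rightarrow> (real^3 \<Rightarrow> real^3) \<Rightarrow> real^3 \<Rightarrow> real^3 \<Rightarrow> real^3" where
  "shape_operator S N p v = - frechet_derivative N (at p within S) v"

definition second_fundamental_form ::
    "(real^3) set \<Rightarrow> (real^3 \<Rightarrow> real^3) \<Rightarrow> real^3 \<Rightarrow> real^3 \<Rightarrow> real^3 \<Rightarrow> real^3" where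
  "second_fundamental_form S N p u v = (shape_operator S N p u \<bullet> v) *\<^sub>R N p"

definition orthonormal_tangent_frame ::
    "(real^3) set \<Rightarrow> real^3 \<Rightarrow> real^3 \<Rightarrow> real^3 \<Rightarrow> bool" where
  "orthonormal_tangent_frame S p u v \<longleftrightarrow>
     u \<in> tangent_plane S p \<and> v \<in> tangent_plane S p \<and> norm u = 1 \<and> norm v = 1 \<and> u \<bullet> v = 0"

(* The trace is independent of the frame, and the unordered pair of principal curvatures is
   unique, so the three definite descriptions below are well defined for a surface S with
   Gauss map N and a point p of S. *)

definition mean_curvature_vector ::
    "(real^3) set \<Rightarrow> (real^3 \<Rightarrow> real^3) \<Rightarrow> real^3 \<Rightarrow> real^3" where
  "mean_curvature_vector S N p =
     (THE h. \<exists>u v. orthonormal_tangent_frame S p u v \<and>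
        h = second_fundamental_form S N p u u + second_fundamental_form S N p v v)"

definition principal_curvatures ::
    "(real^3) set \<Rightarrow> (real^3 \<Rightarrow> real^3) \<Rightarrow> real^3 \<Rightarrow> real \<Rightarrow> real \<Rightarrow> bool" where
  "principal_curvatures S N p k1 k2 \<longleftrightarrow>
     (\<exists>u v. orthonormal_tangent_frame S p u v \<and>
        shape_operator S N p u = k1 *\<^sub>R u \<and> shape_operator S N p v = k2 *\<^sub>R v)"

definition mean_curvature :: "(real^3) set \<Rightarrow> (real^3 \<Rightarrow> real^3) \<Rightarrow> real^3 \<Rightarrow> real" where
  "mean_curvature S N p = (THE h. \<exists>k1 k2. principal_curvatures S N p k1 k2 \<and> h = k1 + k2)"

definition gauss_curvature :: "(real^3) set \<Rightarrow> (real^3 \<Rightarrow> real^3) \<Rightarrow> real^3 \<Rightarrow> real" where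
  "gauss_curvature S N p = (THE k. \<exists>k1 k2. principal_curvatures S N p k1 k2 \<and> k = k1 * k2)"

definition e3 :: "real^3" where
  "e3 = axis 3 1"

(* The Euler-Lagrange equation of the area functional with weight exp (\<phi> (p \<bullet> e3)): the mean
   curvature vector is \<phi>' times the normal component of e3. *)

definition phi_minimal ::
    "(real \<Rightarrow> real) \<Rightarrow> (real^3) set \<Rightarrow> (real^3 \<Rightarrow> real^3) \<Rightarrow> bool" where
  "phi_minimal \<phi> S N \<longleftrightarrow>
     (\<forall>p\<in>S. mean_curvature_vector S N p = deriv \<phi> (p \<bullet> e3) *\<^sub>R ((e3 \<bullet> N p) *\<^sub>R N p))"

definition is_plane :: "(real^3) set \<Rightarrow> bool" where
  "is_plane S \<longleftrightarrow> affine S \<and> aff_dim S = 2"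

end

theory Submission
  imports Defs
begin

text \<open>
  Since \<open>\<langle>N, y0\<rangle>\<close> is bounded away from 0, the surface is locally a graph \<open>u(s, t)\<close> over the vertical
  plane orthogonal to \<open>y0\<close>, with slopes \<open>p\<close>, \<open>q\<close> bounded globally; \<open>t\<close> is the height. Write \<open>m\<close> for
  the derivative of \<open>\<phi>\<close>. Up to the factor \<open>\<langle>N, y0\<rangle>\<close> the mean curvature is the speed \<open>h = m(t) q\<close>.
  Let \<open>L\<close> be the linearized graph operator with \<open>L p = 0\<close>. The signs of \<open>m'\<close>, of \<open>m m''\<close> and of \<open>K\<close>
  give \<open>L (h\<^sup>2) \<ge> 0\<close>, while \<open>L (p\<^sup>2 + q\<^sup>2)\<close> dominates the squared Hessian of \<open>u\<close> and hence \<open>h\<^sup>2\<close>.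
  Since \<open>K \<ge> 0\<close> and \<open>H\<close> is bounded, \<open>L r\<close> is bounded above for \<open>r = sqrt (1 + |P|\<^sup>2)\<close>; the possibly
  unbounded drift does no harm because \<open>t m(t) \<le> t m(0)\<close>. The maximum principle for
  \<open>h\<^sup>2 + \<eta> (p\<^sup>2 + q\<^sup>2) - \<eta>\<^sup>2 r\<close> yields \<open>h = 0\<close> as \<open>\<eta> \<rightarrow> 0\<close>. So \<open>H = 0\<close>, and with \<open>K \<ge> 0\<close> the surface
  is flat.
\<close>

subsection \<open>Calculus of smooth maps\<close>

text \<open>The inequality \<open>L (h^2) \<ge> 0\<close> alone says nothing on a noncompact
  surface: once a multiple of a proper function is subtracted to force a maximum, the maximum
  principle gives no bound on h there. The bounded function p^2 + q^2 repairs this, because its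
  image under L dominates h^2 itself. With weight \<eta> it changes values by at most a multiple of
  \<eta>, while the error \<eta>^2 L r is of higher order. So the gain \<eta> h^2 is at most of
  order \<eta>^2 at the maximum, h^2 is of order \<eta> there, and comparison carries this to every
  fixed point.

  The surface is not assumed to be a global graph. The functions h, p, q and the distance to the
  origin live on the whole surface, the slopes being read off from N; the maximum exists because the
  surface is proper, and only at the maximum point is a local graph chosen. For the same reason the
  bound on L r must not depend on the chart. Connectedness enters only at the end, when local
  flatness is made global.\<close>

lemma Ck_on_cong:
  assumes "open S" "\<And>x. x \<in> S \<Longrightarrow> f x = g x"
  shows "Ck_on k S f \<longleftrightarrow> Ck_on k S g"
  using assms(2)
proof (induction k arbitrary: f g)
  case 0
  then show ?case using continuous_on_cong by auto
next
  case (Suc k)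
  have "f differentiable_on S \<longleftrightarrow> g differentiable_on S"
    unfolding differentiable_on_def
    by (metis Suc.prems zero_less_one differentiable_transform_within)
  moreover have "Ck_on k S (\<lambda>x. frechet_derivative f (at x) v) \<longleftrightarrow>
      Ck_on k S (\<lambda>x. frechet_derivative g (at x) v)"
    if "f differentiable_on S" for v
  proof (rule Suc.IH)
    fix x assume x: "x \<in> S"
    have "f differentiable (at x)"
      using that x assms(1) differentiable_on_eq_differentiable_at by blast
    then show "frechet_derivative f (at x) v = frechet_derivative g (at x) v"
      using frechet_derivative_transform_within_open[OF _ assms(1) x] Suc.prems by metis
  qed
  ultimately show ?case by auto
qed

text \<open>Any family of derivatives may be supplied instead of \<open>frechet_derivative\<close>,
  since derivatives on an open set are unique.\<close>

lemma Ck_on_SucI: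
  assumes "open S" "\<And>x. x \<in> S \<Longrightarrow> (f has_derivative f' x) (at x)"
    and "\<And>v. Ck_on k S (\<lambda>x. f' x v)"
  shows "Ck_on (Suc k) S f"
proof -
  have "f differentiable_on S"
    unfolding differentiable_on_eq_differentiable_at[OF assms(1)]
    using assms(2) by (auto intro: differentiableI)
  moreover have "Ck_on k S (\<lambda>x. frechet_derivative f (at x) v)" for v
  proof -
    have "frechet_derivative f (at x) v = f' x v" if "x \<in> S" for x
      using fun_cong[OF frechet_derivative_at[OF assms(2)[OF that]]] by simp
    then show ?thesis using assms(3)[of v]
      by (subst Ck_on_cong[OF assms(1), where g = "\<lambda>x. f' x v"]) auto
  qed
  ultimately show ?thesis by simp
qed

lemma Ck_on_has_derivative:
  assumes "Ck_on (Suc k) S f" "open S" "x \<in> S"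
  shows "(f has_derivative frechet_derivative f (at x)) (at x)"
proof -
  have "f differentiable_on S" using assms(1) by simp
  then have "f differentiable (at x)"
    using assms(2,3) differentiable_on_eq_differentiable_at by blast
  then show ?thesis
    by (rule frechet_derivative_works[THEN iffD1])
qed

lemma Ck_on_SucD: "Ck_on (Suc k) S f \<Longrightarrow> Ck_on k S f"
proof (induction k arbitrary: f)
  case 0
  then show ?case by (simp add: differentiable_imp_continuous_on)
next
  case (Suc k)
  then show ?case by (metis Ck_on.simps(2))
qed

lemma Ck_on_subset: "Ck_on k S f \<Longrightarrow> T \<subseteq> S \<Longrightarrow> Ck_on k T f"
proof (induction k arbitrary: f)
  case 0
  then show ?case using continuous_on_subset by auto
next
  case (Suc k)
  then show ?case using differentiable_on_subset by (metis Ck_on.simps(2))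
qed

lemma Ck_on_const: "Ck_on k S (\<lambda>x. c)"
  by (induction k arbitrary: c) auto

lemma Ck_on_bounded_linear:
  assumes "open S" "bounded_linear L"
  shows "Ck_on k S L"
proof (cases k)
  case 0
  then show ?thesis using assms(2) by (simp add: linear_continuous_on)
next
  case (Suc n)
  show ?thesis unfolding Suc
    by (rule Ck_on_SucI[where f' = "\<lambda>_. L", OF assms(1)])
      (use assms(2) Ck_on_const in \<open>auto intro: bounded_linear_imp_has_derivative\<close>)
qed

lemma Ck_on_bounded_linear_compose:
  assumes "open S" "bounded_linear L" "Ck_on k S f"
  shows "Ck_on k S (\<lambda>x. L (f x))"
  using assms(3)
proof (induction k arbitrary: f)
  case 0
  then show ?case using assms(2)
    by (auto intro: bounded_linear.continuous_on)
next
  case (Suc k)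
  show ?case
  proof (rule Ck_on_SucI[OF assms(1)])
    fix x assume "x \<in> S"
    then show "((\<lambda>x. L (f x)) has_derivative (\<lambda>v. L (frechet_derivative f (at x) v))) (at x)"
      using bounded_linear.has_derivative[OF assms(2)] Ck_on_has_derivative[OF Suc.prems assms(1)] by blast
  next
    fix v show "Ck_on k S (\<lambda>x. L (frechet_derivative f (at x) v))"
      using Suc.IH Suc.prems by simp
  qed
qed

lemma Ck_on_add:
  assumes "open S" "Ck_on k S f" "Ck_on k S g"
  shows "Ck_on k S (\<lambda>x. f x + g x)"
  using assms(2,3)
proof (induction k arbitrary: f g)
  case 0
  then show ?case by (auto intro: continuous_on_add)
next
  case (Suc k)
  show ?case
  proof (rule Ck_on_SucI[OF assms(1)])
    fix x assume "x \<in> S"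
    then show "((\<lambda>x. f x + g x) has_derivative
        (\<lambda>v. frechet_derivative f (at x) v + frechet_derivative g (at x) v)) (at x)"
      by (intro has_derivative_add Ck_on_has_derivative[OF Suc.prems(1) assms(1)]
          Ck_on_has_derivative[OF Suc.prems(2) assms(1)])
  next
    fix v show "Ck_on k S (\<lambda>x. frechet_derivative f (at x) v + frechet_derivative g (at x) v)"
      using Suc by simp
  qed
qed

lemma Ck_on_sum:
  assumes "open S" "\<And>i. i \<in> I \<Longrightarrow> Ck_on k S (f i)"
  shows "Ck_on k S (\<lambda>x. \<Sum>i\<in>I. f i x)"
  using assms(2)
  by (induction I rule: infinite_finite_induct) (auto intro: Ck_on_const Ck_on_add[OF assms(1)])

lemma Ck_on_scaleR:
  fixes f :: "'a::real_normed_vector \<Rightarrow> real"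
  assumes "open S" "Ck_on k S f" "Ck_on k S g"
  shows "Ck_on k S (\<lambda>x. f x *\<^sub>R g x)"
  using assms(2,3)
proof (induction k arbitrary: f g)
  case 0
  then show ?case by (auto intro: continuous_on_scaleR)
next
  case (Suc k)
  show ?case
  proof (rule Ck_on_SucI[OF assms(1)])
    fix x assume "x \<in> S"
    then show "((\<lambda>x. f x *\<^sub>R g x) has_derivative
        (\<lambda>v. f x *\<^sub>R frechet_derivative g (at x) v + frechet_derivative f (at x) v *\<^sub>R g x)) (at x)"
      by (intro has_derivative_scaleR Ck_on_has_derivative[OF Suc.prems(1) assms(1)]
          Ck_on_has_derivative[OF Suc.prems(2) assms(1)])
  next
    fix v show "Ck_on k S (\<lambda>x. f x *\<^sub>R frechet_derivative g (at x) v
        + frechet_derivative f (at x) v *\<^sub>R g x)"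
      using Suc Ck_on_SucD[OF Suc.prems(1)] Ck_on_SucD[OF Suc.prems(2)]
      by (intro Ck_on_add[OF assms(1)] Suc.IH) auto
  qed
qed

text \<open>In the chain rule the direction fed to the derivative of \<open>g\<close> varies with
  the point, whereas \<open>Ck_on\<close> differentiates along fixed directions. Expanding that
  direction over \<open>Basis\<close> leaves a finite sum of products to which the induction
  applies; this is why the middle space is Euclidean.\<close>

lemma Ck_on_compose:
  fixes f :: "'a::real_normed_vector \<Rightarrow> 'b::euclidean_space"
  assumes "open S" "open T" "f ` S \<subseteq> T" "Ck_on k S f" "Ck_on k T g"
  shows "Ck_on k S (\<lambda>x. g (f x))"
  using assms(4,5)
proof (induction k arbitrary: g)
  case 0
  then show ?case using continuous_on_compose2 assms(3) by auto
next
  case (Suc k)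
  have lin: "linear (frechet_derivative g (at (f x)))" if "x \<in> S" for x
    by (rule has_derivative_linear[OF Ck_on_has_derivative[OF Suc.prems(2) assms(2)]])
      (use assms(3) that in blast)
  show ?case
  proof (rule Ck_on_SucI[OF assms(1)])
    fix x assume x: "x \<in> S"
    have "(f has_derivative frechet_derivative f (at x)) (at x)"
      by (rule Ck_on_has_derivative[OF Suc.prems(1) assms(1) x])
    moreover have "(g has_derivative frechet_derivative g (at (f x))) (at (f x))"
      by (rule Ck_on_has_derivative[OF Suc.prems(2) assms(2)]) (use assms(3) x in blast)
    ultimately have d: "((\<lambda>x. g (f x)) has_derivative
        (\<lambda>v. frechet_derivative g (at (f x)) (frechet_derivative f (at x) v))) (at x)"
      by (rule has_derivative_compose)
    have eq: "frechet_derivative g (at (f x)) w =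
        (\<Sum>b\<in>Basis. (w \<bullet> b) *\<^sub>R frechet_derivative g (at (f x)) b)" for w
    proof -
      have "frechet_derivative g (at (f x)) (\<Sum>b\<in>Basis. (w \<bullet> b) *\<^sub>R b) =
          (\<Sum>b\<in>Basis. (w \<bullet> b) *\<^sub>R frechet_derivative g (at (f x)) b)"
        by (simp only: linear_sum[OF lin[OF x]] linear_cmul[OF lin[OF x]])
      then show ?thesis by (simp only: euclidean_representation)
    qed
    from d show "((\<lambda>x. g (f x)) has_derivative
        (\<lambda>v. \<Sum>b\<in>Basis. (frechet_derivative f (at x) v \<bullet> b) *\<^sub>R frechet_derivative g (at (f x)) b)) (at x)"
      by (simp only: eq[symmetric])
  next
    fix v
    show "Ck_on k S (\<lambda>x. \<Sum>b\<in>Basis. (frechet_derivative f (at x) v \<bullet> b) *\<^sub>R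
        frechet_derivative g (at (f x)) b)"
      using Suc.prems Ck_on_SucD[OF Suc.prems(1)]
      by (intro Ck_on_sum Ck_on_scaleR Suc.IH assms(1)
          Ck_on_bounded_linear_compose[OF assms(1) bounded_linear_inner_left]) auto
  qed
qed

lemma Ck_on_inverse:
  fixes f :: "'a::real_normed_vector \<Rightarrow> real"
  assumes "open S" "Ck_on k S f" "\<And>x. x \<in> S \<Longrightarrow> f x \<noteq> 0"
  shows "Ck_on k S (\<lambda>x. inverse (f x))"
  using assms(2)
proof (induction k)
  case 0
  then show ?case using assms(3) by (auto intro: continuous_on_inverse)
next
  case (Suc k)
  show ?case
  proof (rule Ck_on_SucI[OF assms(1)])
    fix x assume "x \<in> S"
    \<comment> \<open>The derivative is written with a product of two inverses so that the induction
      hypothesis applies to each factor.\<close>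
    then show "((\<lambda>x. inverse (f x)) has_derivative
        (\<lambda>v. (- 1 * frechet_derivative f (at x) v) *\<^sub>R (inverse (f x) *\<^sub>R inverse (f x)))) (at x)"
      using Suc.prems assms(3) Ck_on_has_derivative[OF _ assms(1)]
      by (auto intro!: derivative_eq_intros)
  next
    fix v show "Ck_on k S (\<lambda>x. (- 1 * frechet_derivative f (at x) v) *\<^sub>R
        (inverse (f x) *\<^sub>R inverse (f x)))"
      using Suc.prems Suc.IH Ck_on_SucD[OF Suc.prems]
      by (intro Ck_on_scaleR assms(1) Ck_on_bounded_linear_compose[OF assms(1) bounded_linear_mult_right]) auto
  qed
qed

text \<open>Images of straight segments of the parameter domain are the smooth curves that
  \<open>tangent_plane\<close> asks for.\<close>

lemma smooth_on_line:
  fixes X :: "'a::real_normed_vector \<Rightarrow> 'b::real_normed_vector"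
  assumes "open T" "open S" "smooth_on S X" "\<And>t. t \<in> T \<Longrightarrow> x + t *\<^sub>R v \<in> S"
  shows "smooth_on T (\<lambda>t::real. X (x + t *\<^sub>R v))"
proof -
  have "Ck_on k S X \<Longrightarrow> Ck_on k T (\<lambda>t. X (x + t *\<^sub>R v))" for k
  proof (induction k arbitrary: X)
    case 0
    then show ?case using assms(4)
      by (auto intro!: continuous_on_compose2[of S X] continuous_intros)
  next
    case (Suc k)
    show ?case
    proof (rule Ck_on_SucI[OF assms(1)])
      fix t assume "t \<in> T"
      then have d: "(X has_derivative frechet_derivative X (at (x + t *\<^sub>R v))) (at (x + t *\<^sub>R v))"
        by (intro Ck_on_has_derivative[OF Suc.prems assms(2)] assms(4))
      have "((\<lambda>t. X (x + t *\<^sub>R v)) has_derivative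
          (\<lambda>r. frechet_derivative X (at (x + t *\<^sub>R v)) (r *\<^sub>R v))) (at t)"
        by (rule has_derivative_compose[where f = "\<lambda>t. x + t *\<^sub>R v", OF _ d]) (auto intro!: derivative_eq_intros)
      then show "((\<lambda>t. X (x + t *\<^sub>R v)) has_derivative
          (\<lambda>r. r *\<^sub>R frechet_derivative X (at (x + t *\<^sub>R v)) v)) (at t)"
        using linear_cmul[OF has_derivative_linear[OF d]] by simp
    next
      fix r show "Ck_on k T (\<lambda>t. r *\<^sub>R frechet_derivative X (at (x + t *\<^sub>R v)) v)"
        using Suc.prems by (intro Ck_on_scaleR assms(1) Ck_on_const Suc.IH) auto
    qed
  qed
  then show ?thesis using assms(3) by (simp add: smooth_on_def)
qed

subsection \<open>Symmetry of second derivatives\<close>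

definition grad_at :: "(real^2 \<Rightarrow> real) \<Rightarrow> real^2 \<Rightarrow> real \<Rightarrow> real \<Rightarrow> bool" where
  "grad_at f x d1 d2 \<longleftrightarrow> (f has_derivative (\<lambda>v. v$1 * d1 + v$2 * d2)) (at x)"

lemma grad_at_along:
  assumes "grad_at f (x + t *\<^sub>R v) d1 d2"
  shows "((\<lambda>t. f (x + t *\<^sub>R v)) has_real_derivative v$1 * d1 + v$2 * d2) (at t)"
proof -
  have "((\<lambda>t. f (x + t *\<^sub>R v)) has_derivative (\<lambda>r. (r *\<^sub>R v)$1 * d1 + (r *\<^sub>R v)$2 * d2)) (at t)"
    by (rule has_derivative_compose[where f = "\<lambda>t. x + t *\<^sub>R v", OF _ assms[unfolded grad_at_def]])
      (auto intro!: derivative_eq_intros)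
  then show ?thesis
    unfolding has_field_derivative_def by (rule has_derivative_eq_rhs) (auto simp: algebra_simps)
qed

text \<open>The mean value theorem in one variable and then in the other. Used in both orders of the
  variables, it evaluates one second difference through either mixed partial.\<close>

lemma second_difference:
  fixes F :: "real \<Rightarrow> real \<Rightarrow> real"
  assumes "0 < h"
    and 1: "\<And>s t. 0 \<le> s \<Longrightarrow> s \<le> h \<Longrightarrow> 0 \<le> t \<Longrightarrow> t \<le> h \<Longrightarrow>
      ((\<lambda>s. F s t) has_real_derivative P s t) (at s)"
    and 2: "\<And>s t. 0 \<le> s \<Longrightarrow> s \<le> h \<Longrightarrow> 0 \<le> t \<Longrightarrow> t \<le> h \<Longrightarrow>
      ((\<lambda>t. P s t) has_real_derivative B s t) (at t)"
  obtains s t where "0 < s" "s < h" "0 < t" "t < h"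
    "F h h - F h 0 - F 0 h + F 0 0 = h * h * B s t"
proof -
  have "\<exists>s>0. s < h \<and> (F h h - F h 0) - (F 0 h - F 0 0) = (h - 0) * (P s h - P s 0)"
    by (rule MVT2[OF assms(1), of "\<lambda>s. F s h - F s 0" "\<lambda>s. P s h - P s 0"])
      (use assms(1) in \<open>auto intro!: DERIV_diff 1\<close>)
  then obtain s where s: "0 < s" "s < h" "(F h h - F h 0) - (F 0 h - F 0 0) = h * (P s h - P s 0)"
    by auto
  obtain t where "0 < t" "t < h" "P s h - P s 0 = (h - 0) * B s t"
    using MVT2[OF assms(1), of "P s" "B s"] 2 s by auto
  with s show ?thesis by (intro that[of s t]) auto
qed

text \<open>Schwarz's theorem: over a small square the second difference of \<open>f\<close> is the
  squared side times a value of \<open>b\<close>, and also times a value of \<open>b'\<close>; by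
  continuity both values are close to those at \<open>x\<close>.\<close>

lemma mixed_partials_eq:
  assumes "open S" "x \<in> S"
    and f: "\<And>y. y \<in> S \<Longrightarrow> grad_at f y (p y) (q y)"
    and p: "\<And>y. y \<in> S \<Longrightarrow> grad_at p y (a y) (b y)"
    and q: "\<And>y. y \<in> S \<Longrightarrow> grad_at q y (b' y) (c y)"
    and cont: "continuous_on S b" "continuous_on S b'"
  shows "b x = b' x"
proof (rule ccontr)
  assume ne: "b x \<noteq> b' x"
  define e where "e = \<bar>b x - b' x\<bar> / 2"
  have e: "e > 0" using ne by (simp add: e_def)
  have e2: "\<bar>b x - b' x\<bar> = 2 * e" by (simp add: e_def)
  obtain d0 where d0: "d0 > 0" "ball x d0 \<subseteq> S" using assms(1,2) openE by blast
  obtain d1 where d1: "d1 > 0" "\<And>y. y \<in> S \<Longrightarrow> dist y x < d1 \<Longrightarrow> dist (b y) (b x) < e"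
    using cont(1) assms(2) e unfolding continuous_on_iff by metis
  obtain d2 where d2: "d2 > 0" "\<And>y. y \<in> S \<Longrightarrow> dist y x < d2 \<Longrightarrow> dist (b' y) (b' x) < e"
    using cont(2) assms(2) e unfolding continuous_on_iff by metis
  \<comment> \<open>Points of the square lie within \<open>2 * h\<close> of \<open>x\<close>, and
    this has to stay strictly below all three radii.\<close>
  define h where "h = min d0 (min d1 d2) / 3"
  have h: "h > 0" using d0 d1 d2 by (simp add: h_def)
  define e1 :: "real^2" where "e1 = axis 1 1"
  define e2 :: "real^2" where "e2 = axis 2 1"
  have ax: "e1$1 = 1" "e1$2 = 0" "e2$1 = 0" "e2$2 = 1" by (auto simp: e1_def e2_def axis_def)
  define z where "z = (\<lambda>s t. x + s *\<^sub>R e1 + t *\<^sub>R e2)"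
  have dz: "dist (z s t) x < min d0 (min d1 d2)" if "0 \<le> s" "s \<le> h" "0 \<le> t" "t \<le> h" for s t
  proof -
    have "dist (z s t) x \<le> norm (s *\<^sub>R e1) + norm (t *\<^sub>R e2)"
      unfolding z_def dist_norm using norm_triangle_ineq[of "s *\<^sub>R e1" "t *\<^sub>R e2"]
      by (simp add: algebra_simps)
    also have "\<dots> = s + t" using that by (simp add: e1_def e2_def)
    finally show ?thesis using that h by (simp add: h_def)
  qed
  then have zS: "z s t \<in> S" if "0 \<le> s" "s \<le> h" "0 \<le> t" "t \<le> h" for s t
    using that d0 by (fastforce simp: dist_commute)
  have 1: "((\<lambda>s. g (z s t)) has_real_derivative u1) (at s)" if "grad_at g (z s t) u1 u2" for g s t u1 u2
    using grad_at_along[of g "x + t *\<^sub>R e2" s e1 u1 u2] that by (simp add: z_def ax algebra_simps)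
  have 2: "((\<lambda>t. g (z s t)) has_real_derivative u2) (at t)" if "grad_at g (z s t) u1 u2" for g s t u1 u2
    using grad_at_along[of g "x + s *\<^sub>R e1" t e2 u1 u2] that by (simp add: z_def ax algebra_simps)
  obtain s t where st: "0 < s" "s < h" "0 < t" "t < h"
    "f (z h h) - f (z h 0) - f (z 0 h) + f (z 0 0) = h * h * b (z s t)"
    by (rule second_difference[OF h, of "\<lambda>s t. f (z s t)" "\<lambda>s t. p (z s t)" "\<lambda>s t. b (z s t)"])
      (use 1[OF f] 2[OF p] zS in blast)+
  \<comment> \<open>The same square with the coordinates exchanged; the two middle terms of the
    second difference trade places.\<close>
  obtain t' s' where st': "0 < s'" "s' < h" "0 < t'" "t' < h"
    "f (z h h) - f (z 0 h) - f (z h 0) + f (z 0 0) = h * h * b' (z s' t')"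
    by (rule second_difference[OF h, of "\<lambda>t s. f (z s t)" "\<lambda>t s. q (z s t)" "\<lambda>t s. b' (z s t)"])
      (use 2[OF f] 1[OF q] zS in blast)+
  have "h * h * b (z s t) = h * h * b' (z s' t')" using st(5) st'(5) by linarith
  then have "b (z s t) = b' (z s' t')" using h by simp
  moreover have "dist (b (z s t)) (b x) < e" using d1(2)[OF zS] dz[of s t] st by auto
  moreover have "dist (b' (z s' t')) (b' x) < e" using d2(2)[OF zS] dz[of s' t'] st' by auto
  ultimately show False using e2 unfolding dist_real_def by arith
qed

lemma smooth_on_grad_at:
  fixes f :: "real^2 \<Rightarrow> real"
  assumes "open S" "smooth_on S f"
  obtains p q where "smooth_on S p" "smooth_on S q" "\<And>x. x \<in> S \<Longrightarrow> grad_at f x (p x) (q x)"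
proof -
  define d where "d = (\<lambda>x. frechet_derivative f (at x))"
  have "smooth_on S (\<lambda>x. d x v)" for v
    unfolding smooth_on_def d_def
  proof
    fix k show "Ck_on k S (\<lambda>x. frechet_derivative f (at x) v)"
      using assms(2)[unfolded smooth_on_def, rule_format, of "Suc k"] by simp
  qed
  moreover have "grad_at f x (d x (axis 1 1)) (d x (axis 2 1))" if "x \<in> S" for x
  proof -
    have 1: "(f has_derivative d x) (at x)"
      unfolding d_def by (rule Ck_on_has_derivative[of 0])
        (use assms that in \<open>auto simp only: smooth_on_def\<close>)
    have l: "linear (d x)" using has_derivative_linear[OF 1] .
    have "d x v = v$1 * d x (axis 1 1) + v$2 * d x (axis 2 1)" for v
    proof -
      have "v = v$1 *\<^sub>R axis 1 1 + v$2 *\<^sub>R axis 2 1"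
        by (simp add: vec_eq_iff forall_2 axis_def)
      then have "d x v = d x (v$1 *\<^sub>R axis 1 1 + v$2 *\<^sub>R axis 2 1)" by simp
      then show ?thesis by (simp only: linear_add[OF l] linear_cmul[OF l] real_scaleR_def)
    qed
    then have "d x = (\<lambda>v. v$1 * d x (axis 1 1) + v$2 * d x (axis 2 1))"
      by (rule ext)
    then show ?thesis unfolding grad_at_def
      by (rule has_derivative_eq_rhs[OF 1])
  qed
  ultimately show ?thesis using that by blast
qed

text \<open>The graph equation is of second order and is differentiated once. Sharing
  \<open>b\<close>, \<open>a2\<close> and \<open>b2\<close> between the gradients records the
  symmetry of second and third derivatives, so the later algebra never meets two names for one
  derivative.\<close>

lemma smooth_on_third_partials:
  fixes f :: "real^2 \<Rightarrow> real"
  assumes "open S" "smooth_on S f"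
  obtains p q a b c a1 a2 b2 c2 where
    "\<And>x. x \<in> S \<Longrightarrow> grad_at f x (p x) (q x)"
    "\<And>x. x \<in> S \<Longrightarrow> grad_at p x (a x) (b x)"
    "\<And>x. x \<in> S \<Longrightarrow> grad_at q x (b x) (c x)"
    "\<And>x. x \<in> S \<Longrightarrow> grad_at a x (a1 x) (a2 x)"
    "\<And>x. x \<in> S \<Longrightarrow> grad_at b x (a2 x) (b2 x)"
    "\<And>x. x \<in> S \<Longrightarrow> grad_at c x (b2 x) (c2 x)"
proof -
  have cont: "smooth_on S g \<Longrightarrow> continuous_on S g" for g :: "real^2 \<Rightarrow> real"
    unfolding smooth_on_def using Ck_on.simps(1) by blast
  obtain p q where f: "smooth_on S p" "smooth_on S q" "\<And>x. x \<in> S \<Longrightarrow> grad_at f x (p x) (q x)"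
    using smooth_on_grad_at[OF assms] by metis
  obtain a b where p: "smooth_on S a" "smooth_on S b" "\<And>x. x \<in> S \<Longrightarrow> grad_at p x (a x) (b x)"
    using smooth_on_grad_at[OF assms(1) f(1)] by metis
  obtain b' c where q: "smooth_on S b'" "smooth_on S c" "\<And>x. x \<in> S \<Longrightarrow> grad_at q x (b' x) (c x)"
    using smooth_on_grad_at[OF assms(1) f(2)] by metis
  have b: "b' x = b x" if "x \<in> S" for x
    using mixed_partials_eq[OF assms(1) that f(3) p(3) q(3)] cont p q by simp
  then have q3: "\<And>x. x \<in> S \<Longrightarrow> grad_at q x (b x) (c x)" using q(3) by simp
  obtain a1 a2 where a: "smooth_on S a1" "smooth_on S a2" "\<And>x. x \<in> S \<Longrightarrow> grad_at a x (a1 x) (a2 x)"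
    using smooth_on_grad_at[OF assms(1) p(1)] by metis
  obtain b1 b2 where bb: "smooth_on S b1" "smooth_on S b2" "\<And>x. x \<in> S \<Longrightarrow> grad_at b x (b1 x) (b2 x)"
    using smooth_on_grad_at[OF assms(1) p(2)] by metis
  obtain c1 c2 where c: "smooth_on S c1" "smooth_on S c2" "\<And>x. x \<in> S \<Longrightarrow> grad_at c x (c1 x) (c2 x)"
    using smooth_on_grad_at[OF assms(1) q(2)] by metis
  have "b1 x = a2 x" if "x \<in> S" for x
    using mixed_partials_eq[OF assms(1) that p(3) a(3) bb(3)] cont a bb by simp
  moreover have "c1 x = b2 x" if "x \<in> S" for x
    using mixed_partials_eq[OF assms(1) that q3 bb(3) c(3)] cont bb c by simp
  ultimately show ?thesis using bb(3) c(3) by (intro that[OF f(3) p(3) q3 a(3)]) auto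
qed

subsection \<open>The maximum principle for drift operators in the plane\<close>

lemma grad_at_unique:
  assumes "grad_at f x a b" "grad_at f x c d"
  shows "a = c" "b = d"
proof -
  have "(\<lambda>v::real^2. v$1 * a + v$2 * b) = (\<lambda>v. v$1 * c + v$2 * d)"
    using assms has_derivative_unique unfolding grad_at_def by blast
  from fun_cong[OF this, of "axis 1 1"] fun_cong[OF this, of "axis 2 1"]
  show "a = c" "b = d" by (simp_all add: axis_def)
qed

lemma grad_at_const: "grad_at (\<lambda>y. c) x 0 0"
  unfolding grad_at_def by simp

lemma grad_at_nth1: "grad_at (\<lambda>y. y$1) x 1 0"
  unfolding grad_at_def by (auto intro!: derivative_eq_intros bounded_linear_imp_has_derivative bounded_linear_vec_nth)

lemma grad_at_nth2: "grad_at (\<lambda>y. y$2) x 0 1"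
  unfolding grad_at_def by (auto intro!: derivative_eq_intros bounded_linear_imp_has_derivative bounded_linear_vec_nth)

lemma grad_at_add:
  assumes "grad_at f x a b" "grad_at g x c d"
  shows "grad_at (\<lambda>y. f y + g y) x (a + c) (b + d)"
  using has_derivative_add[OF assms[unfolded grad_at_def]] unfolding grad_at_def
  by (rule has_derivative_eq_rhs) (auto simp: algebra_simps)

lemma grad_at_mult:
  assumes "grad_at f x a b" "grad_at g x c d"
  shows "grad_at (\<lambda>y. f y * g y) x (f x * c + a * g x) (f x * d + b * g x)"
  using has_derivative_mult[OF assms[unfolded grad_at_def]] unfolding grad_at_def
  by (rule has_derivative_eq_rhs) (auto simp: algebra_simps)

lemma grad_at_compose:
  assumes "(\<theta> has_real_derivative d) (at (f x))" "grad_at f x a b"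
  shows "grad_at (\<lambda>y. \<theta> (f y)) x (d * a) (d * b)"
  using has_derivative_compose[OF assms(2)[unfolded grad_at_def]
      assms(1)[unfolded has_field_derivative_def]]
  unfolding grad_at_def by (rule has_derivative_eq_rhs) (auto simp: algebra_simps)

text \<open>First derivatives near the point, second derivatives only at the point: this is what the
  maximum principle uses and what products and compositions preserve. The repeated
  \<open>f12\<close> builds in the symmetry of the Hessian.\<close>

definition jet2 :: "(real^2 \<Rightarrow> real) \<Rightarrow> real^2 \<Rightarrow> real \<Rightarrow> real \<Rightarrow> real \<Rightarrow> real \<Rightarrow> real \<Rightarrow> bool" where
  "jet2 f x f1 f2 f11 f12 f22 \<longleftrightarrow>
     (\<exists>S d1 d2. open S \<and> x \<in> S \<and> (\<forall>y\<in>S. grad_at f y (d1 y) (d2 y)) \<and>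
        d1 x = f1 \<and> d2 x = f2 \<and> grad_at d1 x f11 f12 \<and> grad_at d2 x f12 f22)"

lemma jet2I:
  assumes "open S" "x \<in> S" "\<And>y. y \<in> S \<Longrightarrow> grad_at f y (d1 y) (d2 y)"
    "grad_at d1 x f11 f12" "grad_at d2 x f12 f22" "f1 = d1 x" "f2 = d2 x"
  shows "jet2 f x f1 f2 f11 f12 f22"
  using assms unfolding jet2_def by blast

lemma jet2_const: "jet2 (\<lambda>y. c) x 0 0 0 0 0"
  by (rule jet2I[of UNIV _ _ "\<lambda>_. 0" "\<lambda>_. 0"]) (auto intro: grad_at_const)

lemma jet2_nth1: "jet2 (\<lambda>y. y$1) x 1 0 0 0 0"
  by (rule jet2I[of UNIV _ _ "\<lambda>_. 1" "\<lambda>_. 0"]) (auto intro: grad_at_const grad_at_nth1)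

lemma jet2_nth2: "jet2 (\<lambda>y. y$2) x 0 1 0 0 0"
  by (rule jet2I[of UNIV _ _ "\<lambda>_. 0" "\<lambda>_. 1"]) (auto intro: grad_at_const grad_at_nth2)

lemma jet2_add:
  assumes "jet2 f x f1 f2 f11 f12 f22" "jet2 g x g1 g2 g11 g12 g22"
  shows "jet2 (\<lambda>y. f y + g y) x (f1 + g1) (f2 + g2) (f11 + g11) (f12 + g12) (f22 + g22)"
proof -
  obtain S d1 d2 where f: "open S" "x \<in> S" "\<And>y. y \<in> S \<Longrightarrow> grad_at f y (d1 y) (d2 y)"
    "d1 x = f1" "d2 x = f2" "grad_at d1 x f11 f12" "grad_at d2 x f12 f22"
    using assms(1) unfolding jet2_def by blast
  obtain T e1 e2 where g: "open T" "x \<in> T" "\<And>y. y \<in> T \<Longrightarrow> grad_at g y (e1 y) (e2 y)"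
    "e1 x = g1" "e2 x = g2" "grad_at e1 x g11 g12" "grad_at e2 x g12 g22"
    using assms(2) unfolding jet2_def by blast
  show ?thesis
    by (rule jet2I[of "S \<inter> T" _ _ "\<lambda>y. d1 y + e1 y" "\<lambda>y. d2 y + e2 y"])
      (use f g in \<open>auto intro: grad_at_add\<close>)
qed

lemma jet2_mult:
  assumes "jet2 f x f1 f2 f11 f12 f22" "jet2 g x g1 g2 g11 g12 g22"
  shows "jet2 (\<lambda>y. f y * g y) x (f x * g1 + f1 * g x) (f x * g2 + f2 * g x)
    (f x * g11 + 2 * f1 * g1 + f11 * g x) (f x * g12 + f1 * g2 + f2 * g1 + f12 * g x)
    (f x * g22 + 2 * f2 * g2 + f22 * g x)"
proof -
  obtain S d1 d2 where f: "open S" "x \<in> S" "\<And>y. y \<in> S \<Longrightarrow> grad_at f y (d1 y) (d2 y)"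
    "d1 x = f1" "d2 x = f2" "grad_at d1 x f11 f12" "grad_at d2 x f12 f22"
    using assms(1) unfolding jet2_def by blast
  obtain T e1 e2 where g: "open T" "x \<in> T" "\<And>y. y \<in> T \<Longrightarrow> grad_at g y (e1 y) (e2 y)"
    "e1 x = g1" "e2 x = g2" "grad_at e1 x g11 g12" "grad_at e2 x g12 g22"
    using assms(2) unfolding jet2_def by blast
  note fx = f(3)[OF f(2)] and gx = g(3)[OF g(2)]
  show ?thesis
  proof (rule jet2I[of "S \<inter> T" _ _ "\<lambda>y. f y * e1 y + d1 y * g y" "\<lambda>y. f y * e2 y + d2 y * g y"])
    show "grad_at (\<lambda>y. f y * e1 y + d1 y * g y) x (f x * g11 + 2 * f1 * g1 + f11 * g x)
        (f x * g12 + f1 * g2 + f2 * g1 + f12 * g x)"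
      using grad_at_add[OF grad_at_mult[OF fx g(6)] grad_at_mult[OF f(6) gx]] f g
      by (simp add: algebra_simps)
    show "grad_at (\<lambda>y. f y * e2 y + d2 y * g y) x (f x * g12 + f1 * g2 + f2 * g1 + f12 * g x)
        (f x * g22 + 2 * f2 * g2 + f22 * g x)"
      using grad_at_add[OF grad_at_mult[OF fx g(7)] grad_at_mult[OF f(7) gx]] f g
      by (simp add: algebra_simps)
  qed (use f g in \<open>auto intro: grad_at_mult\<close>)
qed

text \<open>The set \<open>T\<close> admits outer functions that are differentiable only on part of
  the line, such as the square root on the positive reals.\<close>

lemma jet2_compose:
  assumes "jet2 f x f1 f2 f11 f12 f22" "open T" "f x \<in> T"
    and \<theta>: "\<And>r. r \<in> T \<Longrightarrow> (\<theta> has_real_derivative \<theta>' r) (at r)"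
    and \<theta>': "(\<theta>' has_real_derivative d) (at (f x))"
  shows "jet2 (\<lambda>y. \<theta> (f y)) x (\<theta>' (f x) * f1) (\<theta>' (f x) * f2)
    (\<theta>' (f x) * f11 + d * f1 * f1) (\<theta>' (f x) * f12 + d * f1 * f2) (\<theta>' (f x) * f22 + d * f2 * f2)"
proof -
  obtain S d1 d2 where f: "open S" "x \<in> S" "\<And>y. y \<in> S \<Longrightarrow> grad_at f y (d1 y) (d2 y)"
    "d1 x = f1" "d2 x = f2" "grad_at d1 x f11 f12" "grad_at d2 x f12 f22"
    using assms(1) unfolding jet2_def by blast
  note fx = f(3)[OF f(2)]
  have "continuous_on S f"
    unfolding continuous_on_eq_continuous_at[OF f(1)]
    using f(3) has_derivative_continuous unfolding grad_at_def by blast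
  then have op: "open (S \<inter> f -` T)"
    using continuous_open_preimage f(1) assms(2) by blast
  show ?thesis
  proof (rule jet2I[OF op, of _ _ "\<lambda>y. \<theta>' (f y) * d1 y" "\<lambda>y. \<theta>' (f y) * d2 y"])
    show "grad_at (\<lambda>y. \<theta>' (f y) * d1 y) x (\<theta>' (f x) * f11 + d * f1 * f1)
        (\<theta>' (f x) * f12 + d * f1 * f2)"
      using grad_at_mult[OF grad_at_compose[OF \<theta>' fx] f(6)] f
      by (simp add: algebra_simps)
    show "grad_at (\<lambda>y. \<theta>' (f y) * d2 y) x (\<theta>' (f x) * f12 + d * f1 * f2)
        (\<theta>' (f x) * f22 + d * f2 * f2)"
      using grad_at_mult[OF grad_at_compose[OF \<theta>' fx] f(7)] f
      by (simp add: algebra_simps)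
  qed (use f \<theta> assms(3) in \<open>auto intro: grad_at_compose\<close>)
qed

lemma local_max_derivs:
  fixes g :: "real \<Rightarrow> real"
  assumes "e > 0" and g: "\<And>t. \<bar>t\<bar> < e \<Longrightarrow> (g has_real_derivative g' t) (at t)"
    and g': "(g' has_real_derivative k) (at 0)"
    and max: "\<And>t. \<bar>t\<bar> < e \<Longrightarrow> g t \<le> g 0"
  shows "g' 0 = 0" "k \<le> 0"
proof -
  show 0: "g' 0 = 0"
    by (rule DERIV_local_max[OF g assms(1)]) (use max assms(1) in auto)
  show "k \<le> 0"
  proof (rule ccontr)
    \<comment> \<open>A positive second derivative makes \<open>g'\<close> positive just after 0,
      and the mean value theorem then lifts \<open>g\<close> above its maximum.\<close>
    assume "\<not> k \<le> 0"
    then obtain d where d: "d > 0" "\<And>h. 0 < h \<Longrightarrow> h < d \<Longrightarrow> g' 0 < g' (0 + h)"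
      using DERIV_pos_inc_right[OF g'] by auto
    define h where "h = min d e / 2"
    have h: "0 < h" "h < d" "h < e" using d(1) assms(1) by (auto simp: h_def)
    obtain z where z: "0 < z" "z < h" "g h - g 0 = (h - 0) * g' z"
      using MVT2[OF h(1), of g g'] g h by auto
    have "g' z > 0" using d(2)[of z] z h 0 by auto
    then have "h * g' z > 0" using h by simp
    then have "g h > g 0" using z by simp
    with max[of h] h show False by simp
  qed
qed

lemma jet2_local_max:
  assumes "jet2 f x f1 f2 f11 f12 f22" "open T" "x \<in> T" "\<And>y. y \<in> T \<Longrightarrow> f y \<le> f x"
  shows "f1 = 0" "f2 = 0" "v1 * v1 * f11 + 2 * v1 * v2 * f12 + v2 * v2 * f22 \<le> 0"
proof -
  obtain S d1 d2 where f: "open S" "x \<in> S" "\<And>y. y \<in> S \<Longrightarrow> grad_at f y (d1 y) (d2 y)"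
    "d1 x = f1" "d2 x = f2" "grad_at d1 x f11 f12" "grad_at d2 x f12 f22"
    using assms(1) unfolding jet2_def by blast
  have *: "v1 * f1 + v2 * f2 = 0 \<and> v1 * (v1 * f11 + v2 * f12) + v2 * (v1 * f12 + v2 * f22) \<le> 0" for v1 v2
  proof -
    define v :: "real^2" where "v = vector [v1, v2]"
    have v: "v$1 = v1" "v$2 = v2" by (simp_all add: v_def)
    have "open ((\<lambda>t::real. x + t *\<^sub>R v) -` (S \<inter> T))"
      by (rule open_vimage) (use f assms in \<open>auto intro!: continuous_intros\<close>)
    moreover have "0 \<in> (\<lambda>t::real. x + t *\<^sub>R v) -` (S \<inter> T)" using f assms by simp
    ultimately obtain e where "e > 0" "ball 0 e \<subseteq> (\<lambda>t::real. x + t *\<^sub>R v) -` (S \<inter> T)"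
      using openE by blast
    then have e: "e > 0" "\<And>t. \<bar>t\<bar> < e \<Longrightarrow> x + t *\<^sub>R v \<in> S \<inter> T"
      by (auto simp: subset_iff)
    let ?g' = "\<lambda>t. v1 * d1 (x + t *\<^sub>R v) + v2 * d2 (x + t *\<^sub>R v)"
    have g: "((\<lambda>t. f (x + t *\<^sub>R v)) has_real_derivative ?g' t) (at t)" if "\<bar>t\<bar> < e" for t
      using grad_at_along[OF f(3), of x t v] e(2)[OF that] by (simp add: v)
    have "(?g' has_real_derivative v1 * (v1 * f11 + v2 * f12) + v2 * (v1 * f12 + v2 * f22)) (at 0)"
      using grad_at_along[of d1 x 0 v f11 f12] grad_at_along[of d2 x 0 v f12 f22] f
      by (intro DERIV_add DERIV_cmult) (auto simp: v)
    from local_max_derivs[OF e(1) g this] show ?thesis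
      using assms(4) e(2) f(4,5) by simp
  qed
  show "f1 = 0" "f2 = 0" using *[of 1 0] *[of 0 1] by auto
  show "v1 * v1 * f11 + 2 * v1 * v2 * f12 + v2 * v2 * f22 \<le> 0"
    using *[of v1 v2] by (simp add: algebra_simps)
qed

text \<open>The carre du champ of the operator below: \<open>1 + p\<^sup>2 + q\<^sup>2\<close> times
  the inner product of the two gradients in the metric induced on the graph. It is the cross term in
  the product rule and the second-derivative term in the chain rule.\<close>

definition carre :: "real \<Rightarrow> real \<Rightarrow> real \<Rightarrow> real \<Rightarrow> real \<Rightarrow> real \<Rightarrow> real" where
  "carre p q f1 f2 g1 g2 = (1 + q\<^sup>2) * f1 * g1 - p * q * (f1 * g2 + f2 * g1) + (1 + p\<^sup>2) * f2 * g2"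

text \<open>With p and q the slopes of a graph over the plane, the second-order part is the square of
  the area density times that of the Laplacian of the graph.\<close>

definition drift_op ::
    "real \<Rightarrow> real \<Rightarrow> real \<Rightarrow> real \<Rightarrow> (real^2 \<Rightarrow> real) \<Rightarrow> real^2 \<Rightarrow> real \<Rightarrow> real \<Rightarrow> real \<Rightarrow> bool" where
  "drift_op p q \<beta>1 \<beta>2 f x f1 f2 l \<longleftrightarrow>
     (\<exists>f11 f12 f22. jet2 f x f1 f2 f11 f12 f22 \<and>
        l = (1 + q\<^sup>2) * f11 - 2 * p * q * f12 + (1 + p\<^sup>2) * f22 + \<beta>1 * f1 + \<beta>2 * f2)"

lemma drift_opI:
  assumes "jet2 f x f1 f2 f11 f12 f22"
    and "l = (1 + q\<^sup>2) * f11 - 2 * p * q * f12 + (1 + p\<^sup>2) * f22 + \<beta>1 * f1 + \<beta>2 * f2"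
  shows "drift_op p q \<beta>1 \<beta>2 f x f1 f2 l"
  using assms unfolding drift_op_def by blast

text \<open>The coefficient matrix is the identity plus the rank-one square of the vector (q, -p),
  so it dominates the Euclidean form whatever the slopes are.\<close>

lemma carre_nonneg: "f1\<^sup>2 + f2\<^sup>2 \<le> carre p q f1 f2 f1 f2"
proof -
  have "carre p q f1 f2 f1 f2 = f1\<^sup>2 + f2\<^sup>2 + (q * f1 - p * f2)\<^sup>2"
    by (simp add: carre_def power2_eq_square algebra_simps)
  then show ?thesis by simp
qed

lemma drift_op_const: "drift_op p q \<beta>1 \<beta>2 (\<lambda>y. c) x 0 0 0"
  unfolding drift_op_def using jet2_const by fastforce

lemma drift_op_nth1: "drift_op p q \<beta>1 \<beta>2 (\<lambda>y. y$1) x 1 0 \<beta>1"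
  unfolding drift_op_def using jet2_nth1 by fastforce

lemma drift_op_nth2: "drift_op p q \<beta>1 \<beta>2 (\<lambda>y. y$2) x 0 1 \<beta>2"
  unfolding drift_op_def using jet2_nth2 by fastforce

lemma drift_op_add:
  assumes "drift_op p q \<beta>1 \<beta>2 f x f1 f2 l" "drift_op p q \<beta>1 \<beta>2 g x g1 g2 k"
  shows "drift_op p q \<beta>1 \<beta>2 (\<lambda>y. f y + g y) x (f1 + g1) (f2 + g2) (l + k)"
proof -
  obtain f11 f12 f22 where f: "jet2 f x f1 f2 f11 f12 f22"
    "l = (1 + q\<^sup>2) * f11 - 2 * p * q * f12 + (1 + p\<^sup>2) * f22 + \<beta>1 * f1 + \<beta>2 * f2"
    using assms(1) unfolding drift_op_def by blast
  obtain g11 g12 g22 where g: "jet2 g x g1 g2 g11 g12 g22"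
    "k = (1 + q\<^sup>2) * g11 - 2 * p * q * g12 + (1 + p\<^sup>2) * g22 + \<beta>1 * g1 + \<beta>2 * g2"
    using assms(2) unfolding drift_op_def by blast
  show ?thesis
    unfolding drift_op_def
    by (intro exI conjI, rule jet2_add[OF f(1) g(1)])
      (simp add: f g algebra_simps)
qed

text \<open>The carre term depends on the first derivatives of both factors, which is why
  \<open>drift_op\<close> records the gradient together with the value of the operator.\<close>

lemma drift_op_mult:
  assumes "drift_op p q \<beta>1 \<beta>2 f x f1 f2 l" "drift_op p q \<beta>1 \<beta>2 g x g1 g2 k"
  shows "drift_op p q \<beta>1 \<beta>2 (\<lambda>y. f y * g y) x (f x * g1 + f1 * g x) (f x * g2 + f2 * g x)
    (f x * k + l * g x + 2 * carre p q f1 f2 g1 g2)"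
proof -
  obtain f11 f12 f22 where f: "jet2 f x f1 f2 f11 f12 f22"
    "l = (1 + q\<^sup>2) * f11 - 2 * p * q * f12 + (1 + p\<^sup>2) * f22 + \<beta>1 * f1 + \<beta>2 * f2"
    using assms(1) unfolding drift_op_def by blast
  obtain g11 g12 g22 where g: "jet2 g x g1 g2 g11 g12 g22"
    "k = (1 + q\<^sup>2) * g11 - 2 * p * q * g12 + (1 + p\<^sup>2) * g22 + \<beta>1 * g1 + \<beta>2 * g2"
    using assms(2) unfolding drift_op_def by blast
  show ?thesis
    unfolding drift_op_def
    by (intro exI conjI, rule jet2_mult[OF f(1) g(1)])
      (simp add: f g carre_def algebra_simps)
qed

lemma drift_op_compose:
  assumes "drift_op p q \<beta>1 \<beta>2 f x f1 f2 l" "open T" "f x \<in> T"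
    and "\<And>r. r \<in> T \<Longrightarrow> (\<theta> has_real_derivative \<theta>' r) (at r)"
    and "(\<theta>' has_real_derivative d) (at (f x))"
  shows "drift_op p q \<beta>1 \<beta>2 (\<lambda>y. \<theta> (f y)) x (\<theta>' (f x) * f1) (\<theta>' (f x) * f2)
    (\<theta>' (f x) * l + d * carre p q f1 f2 f1 f2)"
proof -
  obtain f11 f12 f22 where f: "jet2 f x f1 f2 f11 f12 f22"
    "l = (1 + q\<^sup>2) * f11 - 2 * p * q * f12 + (1 + p\<^sup>2) * f22 + \<beta>1 * f1 + \<beta>2 * f2"
    using assms(1) unfolding drift_op_def by blast
  show ?thesis
    unfolding drift_op_def
    by (intro exI conjI, rule jet2_compose[OF f(1) assms(2-5)])
      (simp_all add: f carre_def algebra_simps)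
qed

lemma drift_op_local_max:
  assumes "drift_op p q \<beta>1 \<beta>2 f x f1 f2 l" "open T" "x \<in> T" "\<And>y. y \<in> T \<Longrightarrow> f y \<le> f x"
  shows "l \<le> 0"
proof -
  obtain f11 f12 f22 where f: "jet2 f x f1 f2 f11 f12 f22"
    "l = (1 + q\<^sup>2) * f11 - 2 * p * q * f12 + (1 + p\<^sup>2) * f22 + \<beta>1 * f1 + \<beta>2 * f2"
    using assms(1) unfolding drift_op_def by blast
  note max = jet2_local_max[OF f(1) assms(2-4)]
  \<comment> \<open>The gradient vanishes at the maximum, and identity plus rank one splits the
    second-order part into the Hessian evaluated at (1, 0), (0, 1) and (q, -p), each
    nonpositive.\<close>
  have "l = f11 + f22 + (q * q * f11 + 2 * q * (- p) * f12 + (- p) * (- p) * f22)"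
    by (simp add: f(2) max(1) max(2) algebra_simps power2_eq_square)
  then show ?thesis using max(3)[of 1 0] max(3)[of 0 1] max(3)[of q "- p"] by simp
qed

subsection \<open>The graph equation\<close>

text \<open>The weighted trace is a + c plus the Hessian form k at (q, -p). For a semidefinite
  Hessian both have the same sign, so squaring loses nothing, and (a + c)^2 exceeds the squared
  Hessian norm by twice the determinant.\<close>

lemma hessian_trace_bound:
  fixes p q a b c :: real
  assumes "a * c - b\<^sup>2 \<ge> 0"
  shows "a\<^sup>2 + 2 * b\<^sup>2 + c\<^sup>2 \<le> ((1 + q\<^sup>2) * a - 2 * p * q * b + (1 + p\<^sup>2) * c)\<^sup>2"
proof -
  define k where "k = q\<^sup>2 * a - 2 * p * q * b + p\<^sup>2 * c"
  have "(a + c) * k = (q * a - p * b)\<^sup>2 + (q * b - p * c)\<^sup>2 + (p\<^sup>2 + q\<^sup>2) * (a * c - b\<^sup>2)"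
    unfolding k_def by (simp add: power2_eq_square algebra_simps)
  then have "(a + c) * k \<ge> 0" using assms by simp
  then have "0 \<le> 2 * (a * c - b\<^sup>2) + 2 * ((a + c) * k) + k\<^sup>2"
    using assms by (intro add_nonneg_nonneg) auto
  moreover have "((1 + q\<^sup>2) * a - 2 * p * q * b + (1 + p\<^sup>2) * c)\<^sup>2 =
      a\<^sup>2 + 2 * b\<^sup>2 + c\<^sup>2 + (2 * (a * c - b\<^sup>2) + 2 * ((a + c) * k) + k\<^sup>2)"
    unfolding k_def by (simp add: power2_eq_square algebra_simps)
  ultimately show ?thesis by (metis le_add_same_cancel1)
qed

text \<open>Cauchy-Schwarz for symmetric matrices, with a convenient upper bound for the squared
  norm of the coefficient matrix. It holds for every Hessian, in contrast to the converse bound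
  above.\<close>

lemma trace_hessian_bound:
  fixes p q a b c :: real
  shows "((1 + q\<^sup>2) * a - 2 * p * q * b + (1 + p\<^sup>2) * c)\<^sup>2
    \<le> 2 * (1 + p\<^sup>2 + q\<^sup>2)\<^sup>2 * (a\<^sup>2 + 2 * b\<^sup>2 + c\<^sup>2)"
proof -
  have lagrange: "(x * a + 2 * y * b + z * c)\<^sup>2 \<le> (x\<^sup>2 + 2 * y\<^sup>2 + z\<^sup>2) * (a\<^sup>2 + 2 * b\<^sup>2 + c\<^sup>2)"
    for x y z :: real
  proof -
    have "(x\<^sup>2 + 2 * y\<^sup>2 + z\<^sup>2) * (a\<^sup>2 + 2 * b\<^sup>2 + c\<^sup>2) = (x * a + 2 * y * b + z * c)\<^sup>2
       + 2 * (x * b - y * a)\<^sup>2 + (x * c - z * a)\<^sup>2 + 2 * (y * c - z * b)\<^sup>2"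
      by (simp add: power2_eq_square algebra_simps)
    then show ?thesis by simp
  qed
  have "(1 + q\<^sup>2) * a - 2 * p * q * b + (1 + p\<^sup>2) * c = (1 + q\<^sup>2) * a + 2 * (- (p * q)) * b + (1 + p\<^sup>2) * c"
    by (simp add: mult.assoc)
  then have "((1 + q\<^sup>2) * a - 2 * p * q * b + (1 + p\<^sup>2) * c)\<^sup>2 \<le>
      ((1 + q\<^sup>2)\<^sup>2 + 2 * (p * q)\<^sup>2 + (1 + p\<^sup>2)\<^sup>2) * (a\<^sup>2 + 2 * b\<^sup>2 + c\<^sup>2)"
    using lagrange[of "1 + q\<^sup>2" "- (p * q)" "1 + p\<^sup>2"]
    by (simp add: mult.assoc)
  also have "\<dots> \<le> 2 * (1 + p\<^sup>2 + q\<^sup>2)\<^sup>2 * (a\<^sup>2 + 2 * b\<^sup>2 + c\<^sup>2)"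
  proof (rule mult_right_mono)
    have "2 * (1 + p\<^sup>2 + q\<^sup>2)\<^sup>2 = (1 + q\<^sup>2)\<^sup>2 + 2 * (p * q)\<^sup>2 + (1 + p\<^sup>2)\<^sup>2
        + (p\<^sup>2)\<^sup>2 + (q\<^sup>2)\<^sup>2 + 2 * p\<^sup>2 + 2 * q\<^sup>2 + 2 * (p * q)\<^sup>2"
      by (simp add: power2_eq_square algebra_simps)
    then show "(1 + q\<^sup>2)\<^sup>2 + 2 * (p * q)\<^sup>2 + (1 + p\<^sup>2)\<^sup>2 \<le> 2 * (1 + p\<^sup>2 + q\<^sup>2)\<^sup>2"
      by simp
  qed simp
  finally show ?thesis .
qed

text \<open>This is where the sign of the Gauss curvature enters: the second fundamental form has the sign
  of the mean curvature.\<close>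

lemma curvature_pinching:
  fixes p q a b c h :: real
  assumes "a * c - b\<^sup>2 \<ge> 0"
    and E: "(1 + q\<^sup>2) * a - 2 * p * q * b + (1 + p\<^sup>2) * c = - h * (1 + p\<^sup>2 + q\<^sup>2)"
  shows "h * (a + h * (1 + p\<^sup>2)) \<ge> 0"
proof -
  define w where "w = 1 + p\<^sup>2 + q\<^sup>2"
  \<comment> \<open>\<open>s\<close> is the Hessian form at (p q, -(1 + p^2)), the direction
    orthogonal to (1, 0) in the induced metric. A nonnegative determinant makes \<open>a * s\<close>
    nonnegative.\<close>
  define s where "s = (p * q)\<^sup>2 * a - 2 * p * q * (1 + p\<^sup>2) * b + (1 + p\<^sup>2)\<^sup>2 * c"
  have w: "w > 0" unfolding w_def by (simp add: add_pos_nonneg)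
  have as: "a * s = (p * q * a - (1 + p\<^sup>2) * b)\<^sup>2 + (1 + p\<^sup>2)\<^sup>2 * (a * c - b\<^sup>2)"
    unfolding s_def by (simp add: power2_eq_square algebra_simps)
  have "(1 + p\<^sup>2) * ((1 + q\<^sup>2) * a - 2 * p * q * b + (1 + p\<^sup>2) * c) = a * w + s"
    unfolding s_def w_def by (simp add: power2_eq_square algebra_simps)
  then have t: "- h * w * (1 + p\<^sup>2) = a * w + s"
    unfolding E w_def[symmetric] by (simp add: mult.commute)
  \<comment> \<open>By \<open>t\<close> the right-hand side is (a w + s) s, which contains only
    \<open>a * s\<close> and a square.\<close>
  have "(1 + p\<^sup>2) * w\<^sup>2 * (h * (a + h * (1 + p\<^sup>2))) =
      (- h * w * (1 + p\<^sup>2)) * ((- h * w * (1 + p\<^sup>2)) - a * w)"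
    by (simp add: power2_eq_square algebra_simps)
  also have "\<dots> = w * (a * s) + s\<^sup>2"
    unfolding t by (simp add: power2_eq_square algebra_simps)
  also have "\<dots> \<ge> 0" unfolding as using assms(1) w by simp
  finally have "0 \<le> (1 + p\<^sup>2) * w\<^sup>2 * (h * (a + h * (1 + p\<^sup>2)))" .
  moreover have "(1 + p\<^sup>2) * w\<^sup>2 > 0" using w by (simp add: add_pos_nonneg)
  ultimately show ?thesis using zero_le_mult_iff not_less by (metis)
qed

text \<open>Here \<open>p\<close>, \<open>q\<close> are the slopes, \<open>a\<close>,
  \<open>b\<close>, \<open>c\<close> the Hessian and the remaining functions the third derivatives
  of \<open>u\<close>; the second coordinate is the height and \<open>m\<close> the derivative of
  the weight exponent. \<open>equation\<close> is the minimality condition with the factors of the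
  normal cleared. The determinant in \<open>det_nonneg\<close> is the Gauss curvature times the
  squared \<open>1 + p\<^sup>2 + q\<^sup>2\<close>.\<close>

locale graph_equation =
  fixes V :: "(real^2) set" and u p q a b c a1 a2 b2 c2 :: "real^2 \<Rightarrow> real"
    and m m1 m2 :: "real \<Rightarrow> real"
  assumes open_V: "open V"
    and du: "y \<in> V \<Longrightarrow> grad_at u y (p y) (q y)"
    and dp: "y \<in> V \<Longrightarrow> grad_at p y (a y) (b y)"
    and dq: "y \<in> V \<Longrightarrow> grad_at q y (b y) (c y)"
    and da: "y \<in> V \<Longrightarrow> grad_at a y (a1 y) (a2 y)"
    and db: "y \<in> V \<Longrightarrow> grad_at b y (a2 y) (b2 y)"
    and dc: "y \<in> V \<Longrightarrow> grad_at c y (b2 y) (c2 y)"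
    and dm: "(m has_real_derivative m1 t) (at t)"
    and dm1: "(m1 has_real_derivative m2 t) (at t)"
    and equation: "y \<in> V \<Longrightarrow> (1 + (q y)\<^sup>2) * a y - 2 * p y * q y * b y + (1 + (p y)\<^sup>2) * c y
      = - (m (y$2) * q y) * (1 + (p y)\<^sup>2 + (q y)\<^sup>2)"
    and det_nonneg: "y \<in> V \<Longrightarrow> a y * c y - (b y)\<^sup>2 \<ge> 0"
    and m1_nonpos: "m1 t \<le> 0"
    and m_m2_nonneg: "m t * m2 t \<ge> 0"
begin

text \<open>The difference of the two sides of the graph equation vanishes along a short segment
  through \<open>x\<close>, so its derivative does too. The coordinate directions (1, 0) and (0, 1)
  yield the equations for \<open>p\<close> and \<open>q\<close>. Terms of first order in the
  coefficients collapse to multiples of the Hessian determinant.\<close>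

lemma equation_derivative:
  assumes x: "x \<in> V"
  shows "v1 * ((1 + (q x)\<^sup>2) * a1 x - 2 * p x * q x * a2 x + (1 + (p x)\<^sup>2) * b2 x
        + 2 * p x * (a x * c x - (b x)\<^sup>2)
        + m (x$2) * (b x * (1 + (p x)\<^sup>2 + (q x)\<^sup>2) + 2 * q x * (p x * a x + q x * b x)))
      + v2 * ((1 + (q x)\<^sup>2) * a2 x - 2 * p x * q x * b2 x + (1 + (p x)\<^sup>2) * c2 x
        + 2 * q x * (a x * c x - (b x)\<^sup>2) + m1 (x$2) * q x * (1 + (p x)\<^sup>2 + (q x)\<^sup>2)
        + m (x$2) * (c x * (1 + (p x)\<^sup>2 + (q x)\<^sup>2) + 2 * q x * (p x * b x + q x * c x))) = 0"
proof -
  define v :: "real^2" where "v = vector [v1, v2]"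
  have v: "v$1 = v1" "v$2 = v2" by (simp_all add: v_def)
  have "open ((\<lambda>t::real. x + t *\<^sub>R v) -` V)"
    by (rule open_vimage) (use open_V in \<open>auto intro!: continuous_intros\<close>)
  then obtain e where "e > 0" "ball 0 e \<subseteq> (\<lambda>t::real. x + t *\<^sub>R v) -` V"
    using openE[of _ "0::real"] x by force
  then have e: "e > 0" "\<And>t. \<bar>t\<bar> < e \<Longrightarrow> x + t *\<^sub>R v \<in> V" by (auto simp: subset_iff)
  define F where "F = (\<lambda>t. (1 + (q (x + t *\<^sub>R v))\<^sup>2) * a (x + t *\<^sub>R v)
     - 2 * p (x + t *\<^sub>R v) * q (x + t *\<^sub>R v) * b (x + t *\<^sub>R v) + (1 + (p (x + t *\<^sub>R v))\<^sup>2) * c (x + t *\<^sub>R v)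
     + (m (x$2 + t * v2) * q (x + t *\<^sub>R v)) * (1 + (p (x + t *\<^sub>R v))\<^sup>2 + (q (x + t *\<^sub>R v))\<^sup>2))"
  have F0: "F t = 0" if "\<bar>t\<bar> < e" for t
    using equation[OF e(2)[OF that]] by (simp add: F_def v)
  note along = grad_at_along[of _ x 0 v, simplified v]
  have 1: "((\<lambda>t. p (x + t *\<^sub>R v)) has_real_derivative v1 * a x + v2 * b x) (at 0)"
    "((\<lambda>t. q (x + t *\<^sub>R v)) has_real_derivative v1 * b x + v2 * c x) (at 0)"
    "((\<lambda>t. a (x + t *\<^sub>R v)) has_real_derivative v1 * a1 x + v2 * a2 x) (at 0)"
    "((\<lambda>t. b (x + t *\<^sub>R v)) has_real_derivative v1 * a2 x + v2 * b2 x) (at 0)"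
    "((\<lambda>t. c (x + t *\<^sub>R v)) has_real_derivative v1 * b2 x + v2 * c2 x) (at 0)"
    using along dp[OF x] dq[OF x] da[OF x] db[OF x] dc[OF x] by simp_all
  have 2: "((\<lambda>t. m (x$2 + t * v2)) has_real_derivative m1 (x$2) * v2) (at 0)"
  proof -
    have "((\<lambda>t. x$2 + t * v2) has_real_derivative v2) (at 0)"
      by (auto intro!: derivative_eq_intros)
    then show ?thesis
      using DERIV_chain2[of m "m1 (x$2)" "\<lambda>t. x$2 + t * v2" 0 v2 UNIV] dm by simp
  qed
  have "(F has_real_derivative
      v1 * ((1 + (q x)\<^sup>2) * a1 x - 2 * p x * q x * a2 x + (1 + (p x)\<^sup>2) * b2 x
        + 2 * p x * (a x * c x - (b x)\<^sup>2)
        + m (x$2) * (b x * (1 + (p x)\<^sup>2 + (q x)\<^sup>2) + 2 * q x * (p x * a x + q x * b x)))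
      + v2 * ((1 + (q x)\<^sup>2) * a2 x - 2 * p x * q x * b2 x + (1 + (p x)\<^sup>2) * c2 x
        + 2 * q x * (a x * c x - (b x)\<^sup>2) + m1 (x$2) * q x * (1 + (p x)\<^sup>2 + (q x)\<^sup>2)
        + m (x$2) * (c x * (1 + (p x)\<^sup>2 + (q x)\<^sup>2) + 2 * q x * (p x * b x + q x * c x)))) (at 0)"
    unfolding F_def
    by (rule derivative_eq_intros 1 2 refl)+ (simp add: power2_eq_square algebra_simps)
  from DERIV_local_const[OF this e(1)] F0 e(1) show ?thesis by simp
qed

text \<open>The drift is chosen so that differentiating the graph equation in the horizontal direction
  gives exactly \<open>LL p = 0\<close>.\<close>

definition drift1 where "drift1 x = 2 * m (x$2) * q x * p x + 2 * (p x * c x - q x * b x)"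
definition drift2 where "drift2 x = m (x$2) * (1 + (p x)\<^sup>2 + (q x)\<^sup>2) + 2 * m (x$2) * (q x)\<^sup>2
  + 2 * (q x * a x - p x * b x)"

abbreviation LL :: "(real^2 \<Rightarrow> real) \<Rightarrow> real^2 \<Rightarrow> real \<Rightarrow> real \<Rightarrow> real \<Rightarrow> bool" where
  "LL f x \<equiv> drift_op (p x) (q x) (drift1 x) (drift2 x) f x"

text \<open>The Hessian part of the drift is twice the cofactor matrix of the Hessian applied to (p,
  q). Multiplying it by the Hessian gives twice the determinant times (p, q), exactly the quadratic
  terms of the differentiated equation, and this in both coordinate directions at once.\<close>

lemma LL_p:
  assumes "x \<in> V" shows "LL p x (a x) (b x) 0"
proof -
  have "jet2 p x (a x) (b x) (a1 x) (a2 x) (b2 x)"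
    using assms by (intro jet2I[OF open_V]) (auto intro: dp da db)
  then show ?thesis unfolding drift1_def drift2_def
    by (rule drift_opI) (use equation_derivative[OF assms, of 1 0] in \<open>simp add: power2_eq_square algebra_simps\<close>)
qed

text \<open>The same drift works; the right-hand side remains because \<open>m\<close> depends on
  the height, along which this derivative is taken.\<close>

lemma LL_q:
  assumes "x \<in> V"
  shows "LL q x (b x) (c x) (- m1 (x$2) * q x * (1 + (p x)\<^sup>2 + (q x)\<^sup>2))"
proof -
  have "jet2 q x (b x) (c x) (a2 x) (b2 x) (c2 x)"
    using assms by (intro jet2I[OF open_V]) (auto intro: dq db dc)
  then show ?thesis unfolding drift1_def drift2_def
    by (rule drift_opI) (use equation_derivative[OF assms, of 0 1] in \<open>simp add: power2_eq_square algebra_simps\<close>)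
qed

lemma LL_u:
  assumes "x \<in> V"
  shows "LL u x (p x) (q x) (- (m (x$2) * q x) * (1 + (p x)\<^sup>2 + (q x)\<^sup>2)
    + drift1 x * p x + drift2 x * q x)"
proof -
  have "jet2 u x (p x) (q x) (a x) (b x) (c x)"
    using assms by (intro jet2I[OF open_V]) (auto intro: du dp dq)
  then show ?thesis 
    by (rule drift_opI) (use equation[OF assms] in simp)
qed

lemma LL_m:
  "LL (\<lambda>y. m (y$2)) x 0 (m1 (x$2)) (m1 (x$2) * drift2 x + m2 (x$2) * (1 + (p x)\<^sup>2))"
  using drift_op_compose[OF drift_op_nth2, of UNIV x m m1 "m2 (x$2)"] dm dm1
  by (simp add: carre_def)

text \<open>The hypotheses control products such as \<open>m t * m2 t\<close>, not single signs, so
  the image of the speed h acquires a sign only after multiplication by h. Hence h^2 and not h is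
  used.\<close>

lemma LL_speed_sq:
  assumes "x \<in> V"
  obtains l f1 f2 where "LL (\<lambda>y. (m (y$2) * q y) * (m (y$2) * q y)) x f1 f2 l" "l \<ge> 0"
proof -
  define h where "h = m (x$2) * q x"
  define k where "k = m (x$2) * (- m1 (x$2) * q x * (1 + (p x)\<^sup>2 + (q x)\<^sup>2))
    + (m1 (x$2) * drift2 x + m2 (x$2) * (1 + (p x)\<^sup>2)) * q x
    + 2 * carre (p x) (q x) 0 (m1 (x$2)) (b x) (c x)"
  obtain h1 h2 where L: "LL (\<lambda>y. m (y$2) * q y) x h1 h2 k"
    using drift_op_mult[OF LL_m LL_q[OF assms]] unfolding k_def by blast
  have "h * k = (m (x$2) * m2 (x$2)) * ((q x)\<^sup>2 * (1 + (p x)\<^sup>2))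
      + (- 2 * m1 (x$2)) * (h * (a x + h * (1 + (p x)\<^sup>2)))"
  proof -
    \<comment> \<open>The terms with \<open>m1\<close> are completed to the left side of the graph
      equation; substituting it leaves only \<open>a\<close> and the speed, the combination treated
      by \<open>curvature_pinching\<close>.\<close>
    have "k = q x * (1 + (p x)\<^sup>2) * m2 (x$2)
      + 2 * m1 (x$2) * (h * (q x)\<^sup>2 - a x
        + ((1 + (q x)\<^sup>2) * a x - 2 * p x * q x * b x + (1 + (p x)\<^sup>2) * c x))"
      unfolding k_def carre_def drift2_def h_def by (simp add: power2_eq_square algebra_simps)
    also have "\<dots> = q x * (1 + (p x)\<^sup>2) * m2 (x$2) - 2 * m1 (x$2) * (a x + h * (1 + (p x)\<^sup>2))"
      unfolding equation[OF assms] h_def[symmetric] by (simp add: algebra_simps)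
    finally have k: "k = q x * (1 + (p x)\<^sup>2) * m2 (x$2) - 2 * m1 (x$2) * (a x + h * (1 + (p x)\<^sup>2))" .
    show ?thesis unfolding k by (simp add: h_def power2_eq_square algebra_simps)
  qed
  also have "\<dots> \<ge> 0"
  proof -
    have "(m (x$2) * m2 (x$2)) * ((q x)\<^sup>2 * (1 + (p x)\<^sup>2)) \<ge> 0"
      by (rule mult_nonneg_nonneg[OF m_m2_nonneg]) simp
    moreover have "(- 2 * m1 (x$2)) * (h * (a x + h * (1 + (p x)\<^sup>2))) \<ge> 0"
      using curvature_pinching[OF det_nonneg[OF assms] equation[OF assms]] m1_nonpos[of "x$2"]
      unfolding h_def[symmetric] by (intro mult_nonneg_nonneg[of "- 2 * m1 (x$2)"]) simp_all
    ultimately show ?thesis by (rule add_nonneg_nonneg)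
  qed
  finally have "h * k \<ge> 0" .
  moreover have "carre (p x) (q x) h1 h2 h1 h2 \<ge> 0"
    using carre_nonneg[of h1 h2 "p x" "q x"] by (smt (verit) zero_le_power2)
  ultimately have "h * k + k * h + 2 * carre (p x) (q x) h1 h2 h1 h2 \<ge> 0"
    by (simp add: mult.commute)
  then show ?thesis
    using that[OF drift_op_mult[OF L L]] unfolding h_def by simp
qed

text \<open>The two carre terms dominate twice the squared Hessian norm, and the term with
  \<open>m1\<close> has the good sign. In the trace bound the factor \<open>w\<close> of the graph
  equation cancels, so h^2 is dominated with constant 1.\<close>

lemma LL_slope_sq:
  assumes "x \<in> V"
  obtains l f1 f2 where "LL (\<lambda>y. p y * p y + q y * q y) x f1 f2 l" "(m (x$2) * q x)\<^sup>2 \<le> l"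
proof -
  define w where "w = 1 + (p x)\<^sup>2 + (q x)\<^sup>2"
  have w: "w > 0" unfolding w_def by (simp add: add_pos_nonneg)
  define l where "l = 2 * carre (p x) (q x) (a x) (b x) (a x) (b x)
    + 2 * carre (p x) (q x) (b x) (c x) (b x) (c x) - 2 * m1 (x$2) * (q x)\<^sup>2 * w"
  obtain f1 f2 where L: "LL (\<lambda>y. p y * p y + q y * q y) x f1 f2 l"
  proof -
    have "LL (\<lambda>y. p y * p y + q y * q y) x (p x * a x + a x * p x + (q x * b x + b x * q x))
       (p x * b x + b x * p x + (q x * c x + c x * q x)) l"
      using drift_op_add[OF drift_op_mult[OF LL_p[OF assms] LL_p[OF assms]]
          drift_op_mult[OF LL_q[OF assms] LL_q[OF assms]]]
      unfolding l_def w_def by (simp add: power2_eq_square algebra_simps)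
    then show ?thesis using that by blast
  qed
  have "((m (x$2) * q x) * w)\<^sup>2 \<le> 2 * w\<^sup>2 * ((a x)\<^sup>2 + 2 * (b x)\<^sup>2 + (c x)\<^sup>2)"
    using trace_hessian_bound[of "q x" "a x" "p x" "b x" "c x"] equation[OF assms]
    by (simp add: w_def)
  then have "w\<^sup>2 * (m (x$2) * q x)\<^sup>2 \<le> w\<^sup>2 * (2 * ((a x)\<^sup>2 + 2 * (b x)\<^sup>2 + (c x)\<^sup>2))"
    by (simp add: power_mult_distrib algebra_simps)
  then have "(m (x$2) * q x)\<^sup>2 \<le> 2 * ((a x)\<^sup>2 + 2 * (b x)\<^sup>2 + (c x)\<^sup>2)"
    using w by (simp del: power_mult_distrib)
  moreover have "- 2 * m1 (x$2) * (q x)\<^sup>2 * w \<ge> 0"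
    using m1_nonpos w by (simp add: mult_nonneg_nonneg mult_nonpos_nonneg)
  moreover have "l = 2 * carre (p x) (q x) (a x) (b x) (a x) (b x)
    + 2 * carre (p x) (q x) (b x) (c x) (b x) (c x) + (- 2 * m1 (x$2) * (q x)\<^sup>2 * w)"
    unfolding l_def by simp
  ultimately have "(m (x$2) * q x)\<^sup>2 \<le> l"
    using carre_nonneg[of "a x" "b x" "p x" "q x"] carre_nonneg[of "b x" "c x" "p x" "q x"]
    by argo
  with L that show ?thesis by blast
qed

text \<open>The summands bound, in order, the four kinds of terms of \<open>l\<close> in the next
  estimate but one: the carre terms, the height term, the speed term, and the two Hessian terms
  together. Only \<open>m 0\<close> occurs, since \<open>m\<close> itself may be unbounded.\<close>

definition radius_bound :: "real \<Rightarrow> real \<Rightarrow> real" where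
  "radius_bound B M = 4 * B + 2 * \<bar>m 0\<bar> * B + 8 * M * B * (B + 1) + 16 * M * B * B * (B + 1)"

lemma m_mult_le: "m t * t \<le> m 0 * t"
proof (cases "t \<ge> 0")
  case True
  then have "m t \<le> m 0"
    using DERIV_nonpos_imp_nonincreasing[of 0 t m] dm m1_nonpos by blast
  then show ?thesis using True by (rule mult_right_mono)
next
  case False
  then have "m 0 \<le> m t"
    using DERIV_nonpos_imp_nonincreasing[of t 0 m] dm m1_nonpos by force
  then show ?thesis using False by (intro mult_right_mono_neg) auto
qed

lemma LL_radius_sq:
  assumes x: "x \<in> V" and B: "1 + (p x)\<^sup>2 + (q x)\<^sup>2 \<le> B" and M: "\<bar>m (x$2) * q x\<bar> \<le> M"
  obtains l f1 f2 where
    "LL (\<lambda>y. 1 + u y * u y + y$1 * y$1 + y$2 * y$2) x f1 f2 l"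
    "l \<le> radius_bound B M * sqrt (1 + u x * u x + x$1 * x$1 + x$2 * x$2)"
proof -
  define w where "w = 1 + (p x)\<^sup>2 + (q x)\<^sup>2"
  define h where "h = m (x$2) * q x"
  define X where "X = u x * p x + x$1"
  define Y where "Y = u x * q x + x$2"
  define r where "r = sqrt (1 + u x * u x + x$1 * x$1 + x$2 * x$2)"
  \<comment> \<open>The drift contributes \<open>m\<close> times w times \<open>Y\<close>. Its part
    u q m w is u h w and cancels against the second-order part of the operator on \<open>u\<close>.
    So an unbounded \<open>m\<close> survives only in the product of \<open>m\<close> with the
    height.\<close>
  define l where "l = 4 * w + 2 * (m (x$2) * x$2) * w + 4 * (h * (p x * X + q x * Y))
    + 4 * ((p x * c x - q x * b x) * X) + 4 * ((q x * a x - p x * b x) * Y)"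
  obtain f1 f2 where L: "LL (\<lambda>y. 1 + u y * u y + y$1 * y$1 + y$2 * y$2) x f1 f2 l"
  proof -
    note L = drift_op_add[OF drift_op_add[OF drift_op_add[OF drift_op_const[of _ _ _ _ 1]
            drift_op_mult[OF LL_u[OF x] LL_u[OF x]]]
          drift_op_mult[OF drift_op_nth1 drift_op_nth1]] drift_op_mult[OF drift_op_nth2 drift_op_nth2]]
    have eq: "l = 0 +
      (u x * (- (m (x $ 2) * q x) * (1 + (p x)\<^sup>2 + (q x)\<^sup>2) + drift1 x * p x + drift2 x * q x) +
       (- (m (x $ 2) * q x) * (1 + (p x)\<^sup>2 + (q x)\<^sup>2) + drift1 x * p x + drift2 x * q x) * u x +
       2 * carre (p x) (q x) (p x) (q x) (p x) (q x)) +
      (x$1 * drift1 x + drift1 x * x$1 + 2 * carre (p x) (q x) 1 0 1 0) +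
      (x$2 * drift2 x + drift2 x * x$2 + 2 * carre (p x) (q x) 0 1 0 1)"
      unfolding l_def carre_def drift1_def drift2_def X_def Y_def w_def h_def
      by (simp add: power2_eq_square algebra_simps)
    show ?thesis by (rule that) (subst eq, rule L)
  qed
  have w: "1 \<le> w" "w \<le> B" using B by (auto simp: w_def)
  have M0: "M \<ge> 0" and h: "\<bar>h\<bar> \<le> M" using M by (auto simp: h_def)
  have r1: "r \<ge> 1" unfolding r_def by (simp add: add_nonneg_nonneg add.assoc)
  have r: "\<bar>u x\<bar> \<le> r" "\<bar>x$1\<bar> \<le> r" "\<bar>x$2\<bar> \<le> r"
    unfolding r_def by (rule real_le_rsqrt; simp add: power2_eq_square add_nonneg_nonneg)+
  have pq: "\<bar>p x\<bar> \<le> B" "\<bar>q x\<bar> \<le> B"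
  proof -
    have "w \<le> w\<^sup>2" using w by (simp add: power2_eq_square)
    then have "(p x)\<^sup>2 \<le> w\<^sup>2" "(q x)\<^sup>2 \<le> w\<^sup>2" 
      using zero_le_power2[of "p x"] zero_le_power2[of "q x"] unfolding w_def by linarith+
    then have "\<bar>p x\<bar> \<le> \<bar>w\<bar>" "\<bar>q x\<bar> \<le> \<bar>w\<bar>" by (simp_all only: abs_le_square_iff)
    then show "\<bar>p x\<bar> \<le> B" "\<bar>q x\<bar> \<le> B" using w by auto
  qed
  \<comment> \<open>With a nonnegative determinant the trace bounds the whole Hessian, so the bound
    on the speed bounds every second derivative.\<close>
  have abc: "\<bar>a x\<bar> \<le> M * B" "\<bar>b x\<bar> \<le> M * B" "\<bar>c x\<bar> \<le> M * B"
  proof -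
    have "(a x)\<^sup>2 + 2 * (b x)\<^sup>2 + (c x)\<^sup>2 \<le> (h * w)\<^sup>2"
      using hessian_trace_bound[OF det_nonneg[OF x], of "q x" "p x"] equation[OF x]
      by (simp add: h_def w_def)
    then have "(a x)\<^sup>2 \<le> (h * w)\<^sup>2" "(b x)\<^sup>2 \<le> (h * w)\<^sup>2" "(c x)\<^sup>2 \<le> (h * w)\<^sup>2"
      using zero_le_power2[of "a x"] zero_le_power2[of "b x"] zero_le_power2[of "c x"] by linarith+
    then have "\<bar>a x\<bar> \<le> \<bar>h * w\<bar>" "\<bar>b x\<bar> \<le> \<bar>h * w\<bar>" "\<bar>c x\<bar> \<le> \<bar>h * w\<bar>"
      by (simp_all only: abs_le_square_iff)
    moreover have "\<bar>h * w\<bar> \<le> M * B"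
      unfolding abs_mult using h w M0 by (intro mult_mono) auto
    ultimately show "\<bar>a x\<bar> \<le> M * B" "\<bar>b x\<bar> \<le> M * B" "\<bar>c x\<bar> \<le> M * B" by auto
  qed
  have B1: "1 \<le> B" using w by linarith
  have prod: "\<bar>y * z\<bar> \<le> C * D" if "\<bar>y\<bar> \<le> C" "\<bar>z\<bar> \<le> D" for y z C D :: real
    unfolding abs_mult using that by (intro mult_mono) auto
  have XY: "\<bar>X\<bar> \<le> (B + 1) * r" "\<bar>Y\<bar> \<le> (B + 1) * r"
  proof -
    have "\<bar>X\<bar> \<le> r * B + r" "\<bar>Y\<bar> \<le> r * B + r"
      using prod[OF r(1) pq(1)] prod[OF r(1) pq(2)] r unfolding X_def Y_def by (smt (verit))+
    then show "\<bar>X\<bar> \<le> (B + 1) * r" "\<bar>Y\<bar> \<le> (B + 1) * r" by (simp_all add: algebra_simps)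
  qed
  have "4 * w \<le> 4 * B * r"
    using mult_mono[of w B 1 r] w r1 by simp
  \<comment> \<open>The estimate is one-sided: \<open>m\<close> is nonincreasing, so its product
    with the height exceeds the linear term at \<open>m 0\<close> nowhere, though it may be very
    negative.\<close>
  moreover have "2 * (m (x$2) * x$2) * w \<le> 2 * \<bar>m 0\<bar> * B * r"
  proof -
    have "m (x$2) * x$2 \<le> \<bar>m 0\<bar> * r"
      using m_mult_le[of "x$2"] prod[of "m 0" "\<bar>m 0\<bar>" "x$2" r] r(3) by auto
    then have "(m (x$2) * x$2) * w \<le> (\<bar>m 0\<bar> * r) * w"
      using w by (intro mult_right_mono) auto
    also have "\<dots> \<le> (\<bar>m 0\<bar> * r) * B" using w r1 by (intro mult_left_mono) auto
    finally show ?thesis by (simp add: algebra_simps)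
  qed
  moreover have "h * (p x * X + q x * Y) \<le> M * (B * ((B + 1) * r) + B * ((B + 1) * r))"
  proof -
    have "\<bar>p x * X + q x * Y\<bar> \<le> B * ((B + 1) * r) + B * ((B + 1) * r)"
      using prod[OF pq(1) XY(1)] prod[OF pq(2) XY(2)] by linarith
    from prod[OF h this] show ?thesis by linarith
  qed
  moreover have "(p x * c x - q x * b x) * X \<le> (B * (M * B) + B * (M * B)) * ((B + 1) * r)"
  proof -
    have "\<bar>p x * c x - q x * b x\<bar> \<le> B * (M * B) + B * (M * B)"
      using prod[OF pq(1) abc(3)] prod[OF pq(2) abc(2)] by linarith
    from prod[OF this XY(1)] show ?thesis by linarith
  qed
  moreover have "(q x * a x - p x * b x) * Y \<le> (B * (M * B) + B * (M * B)) * ((B + 1) * r)"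
  proof -
    have "\<bar>q x * a x - p x * b x\<bar> \<le> B * (M * B) + B * (M * B)"
      using prod[OF pq(2) abc(1)] prod[OF pq(1) abc(2)] by linarith
    from prod[OF this XY(2)] show ?thesis by linarith
  qed
  ultimately have "l \<le> 4 * B * r + 2 * \<bar>m 0\<bar> * B * r
      + 4 * (M * (B * ((B + 1) * r) + B * ((B + 1) * r)))
      + 4 * ((B * (M * B) + B * (M * B)) * ((B + 1) * r))
      + 4 * ((B * (M * B) + B * (M * B)) * ((B + 1) * r))"
    unfolding l_def by linarith
  also have "\<dots> = radius_bound B M * r"
    unfolding radius_bound_def by (simp add: algebra_simps)
  finally show ?thesis using that[OF L] unfolding r_def by blast
qed

text \<open>Concavity of the square root makes the carre term nonpositive, and dividing a bound
  proportional to the root by twice the root leaves a constant.\<close>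

lemma LL_radius:
  assumes x: "x \<in> V" and B: "1 + (p x)\<^sup>2 + (q x)\<^sup>2 \<le> B" and M: "\<bar>m (x$2) * q x\<bar> \<le> M"
  obtains l f1 f2 where
    "LL (\<lambda>y. sqrt (1 + u y * u y + y$1 * y$1 + y$2 * y$2)) x f1 f2 l" "2 * l \<le> radius_bound B M"
proof -
  obtain k g1 g2 where k: "LL (\<lambda>y. 1 + u y * u y + y$1 * y$1 + y$2 * y$2) x g1 g2 k"
    "k \<le> radius_bound B M * sqrt (1 + u x * u x + x$1 * x$1 + x$2 * x$2)"
    using LL_radius_sq[OF assms] by blast
  define R where "R = 1 + u x * u x + x$1 * x$1 + x$2 * x$2"
  have R: "R > 0" unfolding R_def by (simp add: add_pos_nonneg)
  define d where "d = - (inverse (sqrt R) * (inverse (sqrt R) / 2) * inverse (sqrt R)) / 2"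
  have d: "((\<lambda>r. inverse (sqrt r) / 2) has_real_derivative d) (at R)"
    unfolding d_def using R by (auto intro!: derivative_eq_intros)
  have "d \<le> 0" unfolding d_def using R by simp
  moreover have "carre (p x) (q x) g1 g2 g1 g2 \<ge> 0"
    using carre_nonneg[of g1 g2 "p x" "q x"] by (smt (verit) zero_le_power2)
  ultimately have neg: "d * carre (p x) (q x) g1 g2 g1 g2 \<le> 0" by (rule mult_nonpos_nonneg)
  obtain f1 f2 where "LL (\<lambda>y. sqrt (1 + u y * u y + y$1 * y$1 + y$2 * y$2)) x f1 f2
     (inverse (sqrt R) / 2 * k + d * carre (p x) (q x) g1 g2 g1 g2)"
    using drift_op_compose[OF k(1), of "{0<..}" sqrt "\<lambda>r. inverse (sqrt r) / 2" d] R d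
    unfolding R_def by (auto intro: DERIV_real_sqrt)
  moreover have "2 * (inverse (sqrt R) / 2 * k + d * carre (p x) (q x) g1 g2 g1 g2) \<le> radius_bound B M"
  proof -
    have "inverse (sqrt R) * k \<le> radius_bound B M"
      using k(2) R unfolding R_def[symmetric] by (simp add: field_simps)
    then show ?thesis using neg by simp
  qed
  ultimately show ?thesis using that by blast
qed

lemma speed_bound_at_max:
  assumes x: "x \<in> V" and B: "1 + (p x)\<^sup>2 + (q x)\<^sup>2 \<le> B" and M: "\<bar>m (x$2) * q x\<bar> \<le> M"
    and \<eta>: "\<eta> \<ge> 0" and \<delta>: "\<delta> \<ge> 0"
    and G: "\<And>y. G y = (m (y$2) * q y) * (m (y$2) * q y) + \<eta> * (p y * p y + q y * q y)
      + (- \<delta>) * sqrt (1 + u y * u y + y$1 * y$1 + y$2 * y$2)"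
    and max: "\<And>y. y \<in> V \<Longrightarrow> G y \<le> G x"
  shows "2 * \<eta> * (m (x$2) * q x)\<^sup>2 \<le> \<delta> * radius_bound B M"
proof -
  obtain l1 f1 f2 where 1: "LL (\<lambda>y. (m (y$2) * q y) * (m (y$2) * q y)) x f1 f2 l1" "l1 \<ge> 0"
    using LL_speed_sq[OF x] by blast
  obtain l2 g1 g2 where 2: "LL (\<lambda>y. p y * p y + q y * q y) x g1 g2 l2" "(m (x$2) * q x)\<^sup>2 \<le> l2"
    using LL_slope_sq[OF x] by blast
  obtain l3 h1 h2 where 3: "LL (\<lambda>y. sqrt (1 + u y * u y + y$1 * y$1 + y$2 * y$2)) x h1 h2 l3"
    "2 * l3 \<le> radius_bound B M"
    using LL_radius[OF x B M] by blast
  have "G = (\<lambda>y. (m (y$2) * q y) * (m (y$2) * q y) + \<eta> * (p y * p y + q y * q y)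
      + (- \<delta>) * sqrt (1 + u y * u y + y$1 * y$1 + y$2 * y$2))"
    using G by (rule ext)
  then obtain k1 k2 where L: "LL G x k1 k2 (l1 + \<eta> * l2 + (- \<delta>) * l3)"
    using drift_op_add[OF drift_op_add[OF 1(1) drift_op_mult[OF drift_op_const[of _ _ _ _ \<eta>] 2(1)]]
        drift_op_mult[OF drift_op_const[of _ _ _ _ "- \<delta>"] 3(1)]]
    by (auto simp: carre_def)
  have "l1 + \<eta> * l2 + (- \<delta>) * l3 \<le> 0"
    by (rule drift_op_local_max[OF L open_V x max])
  moreover have "\<eta> * (m (x$2) * q x)\<^sup>2 \<le> \<eta> * l2" using 2(2) \<eta> by (rule mult_left_mono)
  moreover have "\<delta> * (2 * l3) \<le> \<delta> * radius_bound B M" using 3(2) \<delta> by (rule mult_left_mono)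
  ultimately show ?thesis using 1(2) by (simp add: algebra_simps)
qed

end

subsection \<open>Curvatures of a surface from its fundamental forms\<close>

lemma orthonormal_expand3:
  fixes x y z w :: "real^3"
  assumes "norm x = 1" "norm y = 1" "norm z = 1" "x \<bullet> y = 0" "x \<bullet> z = 0" "y \<bullet> z = 0"
  shows "w = (w \<bullet> x) *\<^sub>R x + (w \<bullet> y) *\<^sub>R y + (w \<bullet> z) *\<^sub>R z"
proof -
  have ne: "x \<noteq> y" "x \<noteq> z" "y \<noteq> z"
    using assms by (auto simp: norm_eq_1)
  have po: "pairwise orthogonal {x, y, z}"
    using assms by (auto simp: pairwise_def orthogonal_def inner_commute)
  have "independent {x, y, z}"
    by (rule pairwise_orthogonal_independent[OF po]) (use assms in auto)
  then have "UNIV \<subseteq> span {x, y, z}"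
    by (intro card_ge_dim_independent) (use ne in auto)
  then have "(\<Sum>i\<in>{x, y, z}. (w \<bullet> i) *\<^sub>R i) = w"
    by (intro orthonormal_basis_expand[OF po]) (use assms in auto)
  then show ?thesis using ne by (simp add: add.assoc)
qed

lemma trace_det_in_frame:
  fixes n u v X Y :: "real^3"
  assumes A: "linear A"
    and frame: "norm n = 1" "norm u = 1" "norm v = 1" "u \<bullet> v = 0" "n \<bullet> u = 0" "n \<bullet> v = 0"
    and XY: "n \<bullet> X = 0" "n \<bullet> Y = 0"
    and form: "A X \<bullet> X = L" "A X \<bullet> Y = M" "A Y \<bullet> X = M" "A Y \<bullet> Y = K"
    and gram: "(X \<bullet> X) * (Y \<bullet> Y) - (X \<bullet> Y)\<^sup>2 = w" "w > 0"
  shows "A u \<bullet> v = A v \<bullet> u"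
    and "w * (A u \<bullet> u + A v \<bullet> v) = (Y \<bullet> Y) * L - 2 * (X \<bullet> Y) * M + (X \<bullet> X) * K"
    and "w * ((A u \<bullet> u) * (A v \<bullet> v) - (A u \<bullet> v) * (A v \<bullet> u)) = L * K - M\<^sup>2"
proof -
  define x1 x2 y1 y2 where "x1 = X \<bullet> u" "x2 = X \<bullet> v" "y1 = Y \<bullet> u" "y2 = Y \<bullet> v"
  define a b b' c where "a = A u \<bullet> u" "b = A u \<bullet> v" "b' = A v \<bullet> u" "c = A v \<bullet> v"
  have X: "X = x1 *\<^sub>R u + x2 *\<^sub>R v"
    using orthonormal_expand3[of n u v X] frame XY by (simp add: x1_x2_y1_y2_def inner_commute)
  have Y: "Y = y1 *\<^sub>R u + y2 *\<^sub>R v"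
    using orthonormal_expand3[of n u v Y] frame XY by (simp add: x1_x2_y1_y2_def inner_commute)
  have AX: "A X = x1 *\<^sub>R A u + x2 *\<^sub>R A v" "A Y = y1 *\<^sub>R A u + y2 *\<^sub>R A v"
    by (simp_all add: X Y linear_add[OF A] linear_cmul[OF A])
  have uv: "u \<bullet> u = 1" "v \<bullet> v = 1" "v \<bullet> u = 0" using frame by (auto simp: norm_eq_1 inner_commute)
  have G: "X \<bullet> X = x1\<^sup>2 + x2\<^sup>2" "X \<bullet> Y = x1 * y1 + x2 * y2" "Y \<bullet> Y = y1\<^sup>2 + y2\<^sup>2"
    unfolding X Y by (simp_all add: inner_simps uv frame power2_eq_square)
  have w: "w = (x1 * y2 - x2 * y1)\<^sup>2"
    using gram(1) unfolding G by (simp add: power2_eq_square algebra_simps)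
  have F: "x1 * (x1 * a + x2 * b) + x2 * (x1 * b' + x2 * c) = L"
    "x1 * (y1 * a + y2 * b) + x2 * (y1 * b' + y2 * c) = M"
    "y1 * (x1 * a + x2 * b) + y2 * (x1 * b' + x2 * c) = M"
    "y1 * (y1 * a + y2 * b) + y2 * (y1 * b' + y2 * c) = K"
    using form unfolding AX a_b_b'_c_def by (simp_all add: X Y inner_simps algebra_simps)
  have "(x1 * y2 - x2 * y1) * (b - b') = 0" using F(2,3) by (simp add: algebra_simps)
  then have b: "b = b'" using w gram(2) by auto
  then show "A u \<bullet> v = A v \<bullet> u" by (simp add: a_b_b'_c_def)
  show "w * (A u \<bullet> u + A v \<bullet> v) = (Y \<bullet> Y) * L - 2 * (X \<bullet> Y) * M + (X \<bullet> X) * K"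
    unfolding G w a_b_b'_c_def[symmetric] F(1,2,4)[symmetric] b
    by (simp add: power2_eq_square algebra_simps)
  show "w * ((A u \<bullet> u) * (A v \<bullet> v) - (A u \<bullet> v) * (A v \<bullet> u)) = L * K - M\<^sup>2"
    unfolding G w a_b_b'_c_def[symmetric] F(1,2,4)[symmetric] b
    by (simp add: power2_eq_square algebra_simps)
qed

text \<open>A symmetric form is diagonalized by rotating through half the polar angle of the vector
  formed by the difference of its diagonal entries and twice the off-diagonal entry.\<close>

lemma exists_eigenframe:
  fixes n u v :: "real^3"
  assumes A: "linear A" "n \<bullet> A u = 0" "n \<bullet> A v = 0"
    and frame: "norm n = 1" "norm u = 1" "norm v = 1" "u \<bullet> v = 0" "n \<bullet> u = 0" "n \<bullet> v = 0"
    and sym: "A u \<bullet> v = A v \<bullet> u"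
  obtains u' v' k1 k2 where "norm u' = 1" "norm v' = 1" "u' \<bullet> v' = 0" "n \<bullet> u' = 0" "n \<bullet> v' = 0"
    "A u' = k1 *\<^sub>R u'" "A v' = k2 *\<^sub>R v'"
proof -
  obtain r t where rt: "A u \<bullet> u - A v \<bullet> v = r * cos t" "2 * (A u \<bullet> v) = r * sin t"
    using polar_Ex by blast
  define c s where "c = cos (t / 2)" "s = sin (t / 2)"
  have cs: "c * c + s * s = 1"
    unfolding c_s_def using sin_cos_squared_add[of "t / 2"] by (simp add: power2_eq_square)
  have uv: "u \<bullet> u = 1" "v \<bullet> v = 1" "v \<bullet> u = 0" using frame by (auto simp: norm_eq_1 inner_commute)
  have ct: "cos t = c * c - s * s" "sin t = 2 * (s * c)"
    using cos_double[of "t / 2"] sin_double[of "t / 2"] by (simp_all add: c_s_def power2_eq_square)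
  define u' where "u' = c *\<^sub>R u + s *\<^sub>R v"
  define v' where "v' = (- s) *\<^sub>R u + c *\<^sub>R v"
  have AU: "A u' = c *\<^sub>R A u + s *\<^sub>R A v" "A v' = (- s) *\<^sub>R A u + c *\<^sub>R A v"
    unfolding u'_def v'_def linear_add[OF A(1)] linear_cmul[OF A(1)] by simp_all
  have 1: "norm u' = 1" "norm v' = 1" "u' \<bullet> v' = 0"
    using cs by (simp_all add: norm_eq_1 u'_def v'_def inner_simps uv frame algebra_simps)
  have 2: "n \<bullet> u' = 0" "n \<bullet> v' = 0" by (simp_all add: u'_def v'_def inner_simps frame)
  have "A u' \<bullet> v' = (A u \<bullet> v) * (c * c - s * s) - (A u \<bullet> u - A v \<bullet> v) * (s * c)"
    unfolding AU v'_def using sym by (simp add: inner_simps algebra_simps)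
  also have "\<dots> = 0"
  proof -
    have "2 * ((A u \<bullet> v) * (c * c - s * s) - (A u \<bullet> u - A v \<bullet> v) * (s * c)) =
        (2 * (A u \<bullet> v)) * cos t - (A u \<bullet> u - A v \<bullet> v) * sin t"
      unfolding ct by (simp add: algebra_simps)
    also have "\<dots> = 0" unfolding rt by simp
    finally show ?thesis by simp
  qed
  finally have 3: "A u' \<bullet> v' = 0" .
  have "A v' \<bullet> u' = A u' \<bullet> v'"
    unfolding AU unfolding u'_def v'_def using sym by (simp add: inner_simps algebra_simps)
  with 3 have 4: "A v' \<bullet> u' = 0" by simp
  have 5: "A u' \<bullet> n = 0" "A v' \<bullet> n = 0"
    using A(2,3) by (simp_all add: AU inner_simps inner_commute)
  have "A u' = (A u' \<bullet> n) *\<^sub>R n + (A u' \<bullet> u') *\<^sub>R u' + (A u' \<bullet> v') *\<^sub>R v'"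
    by (rule orthonormal_expand3[OF frame(1) 1(1,2) 2 1(3)])
  also have "\<dots> = (A u' \<bullet> u') *\<^sub>R u'" unfolding 3 5 by simp
  finally have "A u' = (A u' \<bullet> u') *\<^sub>R u'" .
  moreover have "A v' = (A v' \<bullet> n) *\<^sub>R n + (A v' \<bullet> u') *\<^sub>R u' + (A v' \<bullet> v') *\<^sub>R v'"
    by (rule orthonormal_expand3[OF frame(1) 1(1,2) 2 1(3)])
  then have "A v' = (A v' \<bullet> v') *\<^sub>R v'" unfolding 4 5 scaleR_zero_left add_0_left .
  ultimately show ?thesis using that 1 2 by blast
qed

section \<open>Tangent planes, shape operator and principal curvatures of an oriented
  surface\<close>

locale oriented_surface =
  fixes S :: "(real^3) set" and N :: "real^3 \<Rightarrow> real^3"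
  assumes surface: "embedded_surface S"
    and gauss: "gauss_map S N"
begin

lemma norm_N: "P \<in> S \<Longrightarrow> norm (N P) = 1"
  using gauss by (simp add: gauss_map_def)

lemma parametrization:
  assumes "P \<in> S"
  obtains U X x where "local_parametrization S U X" "x \<in> U" "X x = P"
proof -
  obtain U X where "local_parametrization S U X" "P \<in> X ` U"
    using surface assms unfolding embedded_surface_def by blast
  then show ?thesis using that by blast
qed

lemma parametrization_derivative:
  assumes X: "local_parametrization S U X" "x \<in> U"
  shows "(X has_derivative frechet_derivative X (at x)) (at x)"
    and "frechet_derivative X (at x) v \<in> tangent_plane S (X x)"
proof -
  have U: "open U" and sm: "smooth_on U X" using X by (auto simp: local_parametrization_def)
  show d: "(X has_derivative frechet_derivative X (at x)) (at x)"
    by (rule Ck_on_has_derivative[OF _ U X(2), of 0]) (use sm in \<open>simp only: smooth_on_def\<close>)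
  have "open ((\<lambda>t::real. x + t *\<^sub>R v) -` U)"
    by (rule open_vimage) (use U in \<open>auto intro!: continuous_intros\<close>)
  then obtain e where "e > 0" "ball 0 e \<subseteq> (\<lambda>t::real. x + t *\<^sub>R v) -` U"
    using openE[of _ "0::real"] X(2) by force
  then have e: "e > 0" "\<And>t. t \<in> {-e<..<e} \<Longrightarrow> x + t *\<^sub>R v \<in> U" by (auto simp: subset_iff)
  have XS: "X ` U \<subseteq> S" using X(1) openin_imp_subset unfolding local_parametrization_def by blast
  show "frechet_derivative X (at x) v \<in> tangent_plane S (X x)"
    unfolding tangent_plane_def
  proof (intro CollectI exI conjI)
    show "smooth_on {-e<..<e} (\<lambda>t. X (x + t *\<^sub>R v))"
      by (rule smooth_on_line[OF _ U sm]) (use e in auto)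
    have "((\<lambda>t. X (x + t *\<^sub>R v)) has_derivative (\<lambda>r. frechet_derivative X (at x) (r *\<^sub>R v))) (at 0)"
      by (rule has_derivative_compose[where f = "\<lambda>t. x + t *\<^sub>R v" and g = X])
        (use d in \<open>auto intro!: derivative_eq_intros\<close>)
    then show "((\<lambda>t. X (x + t *\<^sub>R v)) has_vector_derivative frechet_derivative X (at x) v) (at 0)"
      unfolding has_vector_derivative_def linear_cmul[OF has_derivative_linear[OF d]] .
  qed (use e XS in auto)
qed

text \<open>A set of velocities of curves is not visibly a subspace. It contains the two-dimensional
  range of the differential of a parametrization and lies in the two-dimensional orthogonal
  complement of the normal, so all three coincide.\<close>

lemma tangent_plane_eq:
  assumes "P \<in> S"
  shows "tangent_plane S P = {v. N P \<bullet> v = 0}"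
proof
  show sub: "tangent_plane S P \<subseteq> {v. N P \<bullet> v = 0}"
    using gauss assms by (auto simp: gauss_map_def)
  obtain U X x where X: "local_parametrization S U X" "x \<in> U" "X x = P"
    using parametrization[OF assms] .
  let ?D = "frechet_derivative X (at x)"
  have lin: "linear ?D" using parametrization_derivative(1)[OF X(1,2)] has_derivative_linear by blast
  have inj: "inj ?D" using X by (auto simp: local_parametrization_def)
  have r: "range ?D \<subseteq> tangent_plane S P" using parametrization_derivative(2)[OF X(1,2)] X(3) by auto
  have "dim (range ?D) = 2" using dim_image_eq[OF lin, of UNIV] inj by simp
  moreover have "dim {v. N P \<bullet> v = 0} = 2"
    using dim_hyperplane[of "N P"] norm_N[OF assms] by force
  ultimately have "range ?D = {v. N P \<bullet> v = 0}"
    by (intro subspace_dim_equal)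
      (use r sub lin in \<open>auto intro: linear_subspace_image subspace_hyperplane\<close>)
  with r show "{v. N P \<bullet> v = 0} \<subseteq> tangent_plane S P" by blast
qed

text \<open>The derivative within \<open>S\<close> is not unique off the tangent plane. A smooth
  extension provides one, and hence the one chosen by \<open>frechet_derivative\<close> is also a
  derivative.\<close>

lemma N_has_derivative:
  assumes "P \<in> S"
  shows "(N has_derivative frechet_derivative N (at P within S)) (at P within S)"
proof -
  obtain V F where V: "open V" "P \<in> V" "smooth_on V F" "\<forall>q\<in>S \<inter> V. F q = N q"
    using gauss assms unfolding gauss_map_def smooth_on_surface_def by blast
  have "(F has_derivative frechet_derivative F (at P)) (at P)"
    by (rule Ck_on_has_derivative[OF _ V(1,2), of 0]) (use V in \<open>simp only: smooth_on_def\<close>)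
  then have F: "(F has_derivative frechet_derivative F (at P)) (at P within S)"
    by (rule has_derivative_at_withinI)
  obtain d where d: "d > 0" "ball P d \<subseteq> V" using V openE by blast
  have "(N has_derivative frechet_derivative F (at P)) (at P within S)"
    by (rule has_derivative_transform_within[OF F d(1) assms])
      (use V(4) d(2) in \<open>auto simp: subset_iff dist_commute\<close>)
  then show ?thesis using frechet_derivative_works differentiableI by blast
qed

lemma N_continuous: "continuous_on S N"
  using N_has_derivative has_derivative_continuous
  unfolding continuous_on_eq_continuous_within by blast

lemma shape_operator_linear: "P \<in> S \<Longrightarrow> linear (shape_operator S N P)"
  using has_derivative_linear[OF N_has_derivative, of P]
  unfolding shape_operator_def[abs_def] by (intro linear_compose_neg)

text \<open>Turns the definite descriptions of the curvatures into the classical formulas in any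
  tangent basis \<open>X\<close>, \<open>Y\<close>. As above, \<open>K\<close> is a coefficient of
  the second form.\<close>

lemma curvatures:
  assumes P: "P \<in> S" and XY: "N P \<bullet> X = 0" "N P \<bullet> Y = 0"
    and AXY: "N P \<bullet> shape_operator S N P X = 0" "N P \<bullet> shape_operator S N P Y = 0"
    and form: "shape_operator S N P X \<bullet> X = L" "shape_operator S N P X \<bullet> Y = M"
      "shape_operator S N P Y \<bullet> X = M" "shape_operator S N P Y \<bullet> Y = K"
    and gram: "(X \<bullet> X) * (Y \<bullet> Y) - (X \<bullet> Y)\<^sup>2 = w" "w > 0"
  shows "w * mean_curvature S N P = (Y \<bullet> Y) * L - 2 * (X \<bullet> Y) * M + (X \<bullet> X) * K"
    and "w * gauss_curvature S N P = L * K - M\<^sup>2"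
    and "mean_curvature_vector S N P = mean_curvature S N P *\<^sub>R N P"
proof -
  let ?A = "shape_operator S N P"
  note A = shape_operator_linear[OF P] and n = norm_N[OF P]
  have frame: "orthonormal_tangent_frame S P u v \<longleftrightarrow>
      norm u = 1 \<and> norm v = 1 \<and> u \<bullet> v = 0 \<and> N P \<bullet> u = 0 \<and> N P \<bullet> v = 0" for u v
    unfolding orthonormal_tangent_frame_def tangent_plane_eq[OF P] by auto
  define t where "t = ((Y \<bullet> Y) * L - 2 * (X \<bullet> Y) * M + (X \<bullet> X) * K) / w"
  define d where "d = (L * K - M\<^sup>2) / w"
  have td: "?A u \<bullet> v = ?A v \<bullet> u" "?A u \<bullet> u + ?A v \<bullet> v = t"
    "(?A u \<bullet> u) * (?A v \<bullet> v) - (?A u \<bullet> v) * (?A v \<bullet> u) = d"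
    if "orthonormal_tangent_frame S P u v" for u v
    using trace_det_in_frame[OF A n _ _ _ _ _ XY form gram, of u v] that gram(2) unfolding frame
    by (auto simp: t_def d_def field_simps)
  obtain u v where uv: "orthonormal_tangent_frame S P u v"
  proof -
    have "X \<noteq> 0" using gram by auto
    define u where "u = (1 / norm X) *\<^sub>R X"
    have u: "norm u = 1" "N P \<bullet> u = 0" using \<open>X \<noteq> 0\<close> XY by (auto simp: u_def)
    have "(norm (cross3 (N P) u))\<^sup>2 = 1" unfolding norm_cross using u n by simp
    then have "norm (cross3 (N P) u) = 1" 
      using norm_ge_zero[of "cross3 (N P) u"] by (auto simp: power2_eq_1_iff)
    then have "orthonormal_tangent_frame S P u (cross3 (N P) u)"
      unfolding frame using u by (simp add: dot_cross_self)
    then show ?thesis using that by blast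
  qed
  have A_tangent: "N P \<bullet> ?A z = 0" if z: "N P \<bullet> z = 0" for z
  proof -
    \<comment> \<open>Cramer's rule: \<open>y\<close> is \<open>w\<close> times the projection of
      \<open>z\<close> to the span of \<open>X\<close> and \<open>Y\<close>. The remainder
      \<open>e\<close> is tangent and orthogonal to both, hence zero.\<close>
    define y where "y = ((Y \<bullet> Y) * (X \<bullet> z) - (X \<bullet> Y) * (Y \<bullet> z)) *\<^sub>R X
      + ((X \<bullet> X) * (Y \<bullet> z) - (X \<bullet> Y) * (X \<bullet> z)) *\<^sub>R Y"
    define e where "e = w *\<^sub>R z - y"
    have gram': "w = (X \<bullet> X) * (Y \<bullet> Y) - (X \<bullet> Y) * (X \<bullet> Y)" using gram(1) by (simp add: power2_eq_square)
    have e: "N P \<bullet> e = 0" "X \<bullet> e = 0" "Y \<bullet> e = 0"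
      unfolding e_def y_def gram' using XY z by (simp_all add: inner_simps inner_commute[of Y X] algebra_simps)
    have u: "norm u = 1" "norm v = 1" "u \<bullet> v = 0" "N P \<bullet> u = 0" "N P \<bullet> v = 0"
      using uv unfolding frame by auto
    have X: "X = (X \<bullet> u) *\<^sub>R u + (X \<bullet> v) *\<^sub>R v" and Y: "Y = (Y \<bullet> u) *\<^sub>R u + (Y \<bullet> v) *\<^sub>R v"
      and E: "e = (e \<bullet> u) *\<^sub>R u + (e \<bullet> v) *\<^sub>R v"
      using orthonormal_expand3[of "N P" u v] n u XY e by (metis inner_commute scale_zero_left add_0)+
    have uu: "u \<bullet> u = 1" "v \<bullet> v = 1" "v \<bullet> u = 0" using u by (auto simp: norm_eq_1 inner_commute)
    define x1 x2 y1 y2 z1 z2 where d: "x1 = X \<bullet> u" "x2 = X \<bullet> v" "y1 = Y \<bullet> u" "y2 = Y \<bullet> v"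
      "z1 = e \<bullet> u" "z2 = e \<bullet> v"
    note X = X[folded d] and Y = Y[folded d] and E = E[folded d]
    have 1: "x1 * z1 + x2 * z2 = 0" "y1 * z1 + y2 * z2 = 0"
      using e(2,3) unfolding X Y E by (simp_all add: inner_simps uu u algebra_simps)
    have w: "w = (x1 * y2 - x2 * y1)\<^sup>2"
      using gram' unfolding X Y by (simp add: inner_simps uu u power2_eq_square algebra_simps)
    have "(x1 * y2 - x2 * y1) * z1 = y2 * (x1 * z1 + x2 * z2) - x2 * (y1 * z1 + y2 * z2)"
      "(x1 * y2 - x2 * y1) * z2 = x1 * (y1 * z1 + y2 * z2) - y1 * (x1 * z1 + x2 * z2)"
      by (simp_all add: algebra_simps)
    then have "z1 = 0" "z2 = 0" using 1 w gram(2) by auto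
    then have "w *\<^sub>R z = y" using E by (simp add: e_def)
    then have "w * (N P \<bullet> ?A z) = N P \<bullet> ?A y"
      by (metis inner_scaleR_right linear_cmul[OF A])
    also have "\<dots> = 0"
      unfolding y_def linear_add[OF A] linear_cmul[OF A] using AXY by (simp add: inner_simps)
    finally show ?thesis using gram(2) by simp
  qed
  obtain u' v' k1 k2 where k: "principal_curvatures S N P k1 k2"
  proof -
    have "N P \<bullet> ?A u = 0" "N P \<bullet> ?A v = 0" using A_tangent uv unfolding frame by auto
    then show ?thesis
      using exists_eigenframe[OF A _ _ n _ _ _ _ _ td(1)[OF uv]] uv that
      unfolding principal_curvatures_def frame by metis
  qed
  \<comment> \<open>Every pair of principal curvatures has the frame-independent trace and
    determinant as sum and product; this gives uniqueness for the definite descriptions.\<close>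
  have pc: "k1 + k2 = t \<and> k1 * k2 = d" if pc: "principal_curvatures S N P k1 k2" for k1 k2
  proof -
    obtain u v where "orthonormal_tangent_frame S P u v" "?A u = k1 *\<^sub>R u" "?A v = k2 *\<^sub>R v"
      using pc unfolding principal_curvatures_def by blast
    then show ?thesis using td(2,3)[of u v] unfolding frame by (auto simp: norm_eq_1)
  qed
  have H: "mean_curvature S N P = t"
    unfolding mean_curvature_def by (rule the_equality) (use k pc in blast)+
  then show "w * mean_curvature S N P = (Y \<bullet> Y) * L - 2 * (X \<bullet> Y) * M + (X \<bullet> X) * K"
    using gram(2) by (simp add: t_def)
  have "gauss_curvature S N P = d"
    unfolding gauss_curvature_def by (rule the_equality) (use k pc in blast)+
  then show "w * gauss_curvature S N P = L * K - M\<^sup>2"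
    using gram(2) by (simp add: d_def)
  show "mean_curvature_vector S N P = mean_curvature S N P *\<^sub>R N P"
    unfolding mean_curvature_vector_def H second_fundamental_form_def
    by (rule the_equality) (use uv td(2) in \<open>auto simp flip: scaleR_left_distrib\<close>)
qed

end

subsection \<open>A surface transversal to a direction is locally a graph\<close>

text \<open>The surface is viewed over the plane spanned by \<open>e\<close> and \<open>f\<close> in
  the direction \<open>n\<close>. In the application \<open>f\<close> is vertical, so the second
  base coordinate is the height.\<close>

locale transversal_surface = oriented_surface +
  fixes n e f :: "real^3"
  assumes norms: "norm n = 1" "norm e = 1" "norm f = 1"
    and orth: "n \<bullet> e = 0" "n \<bullet> f = 0" "e \<bullet> f = 0"
    and transversal: "P \<in> S \<Longrightarrow> N P \<bullet> n > 0"
begin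

definition proj :: "real^3 \<Rightarrow> real^2" where
  "proj x = vector [x \<bullet> e, x \<bullet> f]"

definition lift :: "(real^2 \<Rightarrow> real) \<Rightarrow> real^2 \<Rightarrow> real^3" where
  "lift u y = u y *\<^sub>R n + y$1 *\<^sub>R e + y$2 *\<^sub>R f"

lemma proj_nth [simp]: "proj x $ 1 = x \<bullet> e" "proj x $ 2 = x \<bullet> f"
  by (simp_all add: proj_def)

lemma proj_eq_iff: "proj x = y \<longleftrightarrow> x \<bullet> e = y$1 \<and> x \<bullet> f = y$2"
  by (simp add: vec_eq_iff forall_2)

lemma bounded_linear_proj: "bounded_linear proj"
  by (intro linear_conv_bounded_linear[THEN iffD1] linearI)
    (simp_all add: proj_eq_iff inner_simps)

lemma frame_inner [simp]: "n \<bullet> n = 1" "e \<bullet> e = 1" "f \<bullet> f = 1" "n \<bullet> e = 0" "e \<bullet> n = 0"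
  "n \<bullet> f = 0" "f \<bullet> n = 0" "e \<bullet> f = 0" "f \<bullet> e = 0"
  using norms orth by (auto simp: norm_eq_1 inner_commute)

lemma frame_expand: "x = (x \<bullet> n) *\<^sub>R n + (x \<bullet> e) *\<^sub>R e + (x \<bullet> f) *\<^sub>R f"
  by (rule orthonormal_expand3) (use norms orth in auto)

lemma proj_lift [simp]: "proj (lift u y) = y"
  by (simp add: proj_eq_iff lift_def inner_simps)

lemma lift_inner [simp]: "lift u y \<bullet> n = u y" "lift u y \<bullet> e = y$1" "lift u y \<bullet> f = y$2"
  by (simp_all add: lift_def inner_simps)

lemma lift_proj: "u (proj x) = x \<bullet> n \<Longrightarrow> lift u (proj x) = x"
  using frame_expand[of x] by (simp add: lift_def)

lemma lift_has_derivative: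
  assumes "(u has_derivative u') (at y)"
  shows "(lift u has_derivative (\<lambda>v. u' v *\<^sub>R n + v$1 *\<^sub>R e + v$2 *\<^sub>R f)) (at y)"
  unfolding lift_def
  by (auto intro!: derivative_eq_intros assms bounded_linear_imp_has_derivative bounded_linear_vec_nth)

lemma lift_continuous:
  assumes "continuous_on V u" shows "continuous_on V (lift u)"
  unfolding lift_def by (intro continuous_intros assms)

lemma Ck_on_lift:
  assumes "open V" "Ck_on k V u" shows "Ck_on k V (lift u)"
  unfolding lift_def
  by (intro Ck_on_add Ck_on_scaleR assms Ck_on_const Ck_on_bounded_linear bounded_linear_vec_nth)

text \<open>The projection of a parametrization is a local diffeomorphism: a tangent vector in the
  kernel of the projection is a multiple of \<open>n\<close>, and transversality forces it to
  vanish. The graph function is the \<open>n\<close>-component of the parametrization after the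
  local inverse.\<close>

lemma differentiable_graph:
  assumes "P \<in> S"
  obtains V u u' where "open V" "proj P \<in> V" "lift u (proj P) = P" "openin (top_of_set S) (lift u ` V)"
    "\<forall>y\<in>V. (u has_derivative u' y) (at y)"
    "\<forall>y\<in>V. \<forall>v. N (lift u y) \<bullet> (u' y v *\<^sub>R n + v$1 *\<^sub>R e + v$2 *\<^sub>R f) = 0"
proof -
  obtain U X x0 where X: "local_parametrization S U X" "x0 \<in> U" "X x0 = P"
    using parametrization[OF assms] .
  have U: "open U" and smX: "smooth_on U X" and op: "openin (top_of_set S) (X ` U)"
    and inj: "inj (frechet_derivative X (at x0))"
    using X by (auto simp: local_parametrization_def)
  obtain Y where homX: "homeomorphism U (X ` U) X Y"
    using X(1) by (auto simp: local_parametrization_def)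
  have XS: "X ` U \<subseteq> S" using op openin_imp_subset by blast
  note dX = parametrization_derivative[OF X(1)]
  have perp: "N (X x) \<bullet> frechet_derivative X (at x) v = 0" if "x \<in> U" for x v
    using dX(2)[OF that] tangent_plane_eq XS that by auto
  \<comment> \<open>The inverse function theorem is applied with a derivative continuous in the
    operator norm, so the differentials are packed as bounded linear maps.\<close>
  define F' where "F' = (\<lambda>x. Blinfun (\<lambda>v. proj (frechet_derivative X (at x) v)))"
  have bl: "bounded_linear (\<lambda>v. proj (frechet_derivative X (at x) v))" if "x \<in> U" for x
    using bounded_linear_compose[OF bounded_linear_proj has_derivative_bounded_linear[OF dX(1)[OF that]]] .
  have F'_apply: "blinfun_apply (F' x) v = proj (frechet_derivative X (at x) v)" if "x \<in> U" for x v
    unfolding F'_def by (simp add: bounded_linear_Blinfun_apply[OF bl[OF that]])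
  have dF: "((\<lambda>x. proj (X x)) has_derivative blinfun_apply (F' x)) (at x)" if "x \<in> U" for x
    using bounded_linear.has_derivative[OF bounded_linear_proj dX(1)[OF that]]
    by (rule has_derivative_eq_rhs) (simp add: F'_apply[OF that] fun_eq_iff)
  have contF: "continuous_on U F'"
  proof (rule continuous_on_blinfun_componentwise)
    fix v
    have "continuous_on U (\<lambda>x. frechet_derivative X (at x) v)"
      using smX[unfolded smooth_on_def, rule_format, of "Suc 0"] by simp
    then have "continuous_on U (\<lambda>x. proj (frechet_derivative X (at x) v))"
      by (rule bounded_linear.continuous_on[OF bounded_linear_proj])
    then show "continuous_on U (\<lambda>x. blinfun_apply (F' x) v)"
      by (subst continuous_on_cong[OF refl F'_apply])
  qed
  have linF: "linear (blinfun_apply (F' x0))"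
    using blinfun.bounded_linear_right bounded_linear.linear by blast
  have "inj (blinfun_apply (F' x0))"
  proof (subst linear_injective_0[OF linF], intro allI impI)
    fix v assume "blinfun_apply (F' x0) v = 0"
    then have "proj (frechet_derivative X (at x0) v) = 0" using F'_apply X(2) by simp
    then have D: "frechet_derivative X (at x0) v = (frechet_derivative X (at x0) v \<bullet> n) *\<^sub>R n"
      using frame_expand[of "frechet_derivative X (at x0) v"] by (simp add: proj_eq_iff)
    then have "(frechet_derivative X (at x0) v \<bullet> n) * (N P \<bullet> n) = 0"
    proof -
      have "N P \<bullet> ((frechet_derivative X (at x0) v \<bullet> n) *\<^sub>R n) = 0"
        using perp[OF X(2), of v] X(3) D by simp
      then show ?thesis by simp
    qed
    then have "frechet_derivative X (at x0) v \<bullet> n = 0"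
      using transversal[OF assms] by simp
    then have "frechet_derivative X (at x0) v = 0"
      by (subst D) simp
    then show "v = 0"
      using inj linear_injective_0[OF has_derivative_linear[OF dX(1)[OF X(2)]]] by blast
  qed
  then obtain g where g: "linear g" "g \<circ> blinfun_apply (F' x0) = id"
    using linear_injective_left_inverse[OF linF] by blast
  have inv: "Blinfun g o\<^sub>L F' x0 = id_blinfun"
  proof (rule blinfun_eqI)
    fix v show "blinfun_apply (Blinfun g o\<^sub>L F' x0) v = blinfun_apply id_blinfun v"
    proof -
      have "bounded_linear g" using g(1) by (simp only: linear_conv_bounded_linear)
      moreover have "g (blinfun_apply (F' x0) v) = v" using fun_cong[OF g(2), of v] by simp
      ultimately show ?thesis by (simp add: bounded_linear_Blinfun_apply)
    qed
  qed
  have "\<exists>U' V Z Z'. open U' \<and> U' \<subseteq> U \<and> x0 \<in> U' \<and> open V \<and> proj (X x0) \<in> V \<and>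
    homeomorphism U' V (\<lambda>x. proj (X x)) Z \<and> (\<forall>y\<in>V. (Z has_derivative Z' y) (at y))"
  proof (rule inverse_function_theorem[OF U dF contF X(2) inv])
    fix U' V Z Z'
    assume "open U'" "U' \<subseteq> U" "x0 \<in> U'" "open V" "proj (X x0) \<in> V"
      "homeomorphism U' V (\<lambda>x. proj (X x)) Z" "\<And>y. y \<in> V \<Longrightarrow> (Z has_derivative Z' y) (at y)"
    then show ?thesis by (intro exI[of _ U'] exI[of _ V] exI[of _ Z] exI[of _ Z']) simp
  qed
  then obtain U' V Z Z' where Z: "open U'" "U' \<subseteq> U" "x0 \<in> U'" "open V" "proj (X x0) \<in> V"
    "homeomorphism U' V (\<lambda>x. proj (X x)) Z" and dZ: "\<forall>y\<in>V. (Z has_derivative Z' y) (at y)"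
    by (elim exE conjE)
  define u where "u = (\<lambda>y. X (Z y) \<bullet> n)"
  have ZU: "Z y \<in> U'" "proj (X (Z y)) = y" if "y \<in> V" for y
    using Z(6) that unfolding homeomorphism_def by auto
  have lift: "lift u y = X (Z y)" if "y \<in> V" for y
    using lift_proj[of u "X (Z y)"] ZU(2)[OF that] by (simp add: u_def)
  have "Z ` V = U'" using Z(6) unfolding homeomorphism_def by auto
  then have im: "lift u ` V = X ` U'"
    using lift by force
  have "openin (top_of_set (X ` U)) (X ` U')"
    by (rule homeomorphism_imp_open_map[OF homX]) (use openin_open_eq[OF U] Z in blast)
  then have o: "openin (top_of_set S) (lift u ` V)" unfolding im using op openin_trans by blast
  have "Z (proj P) = x0" using Z(3,6) X(3) unfolding homeomorphism_def by auto
  then have P: "lift u (proj P) = P" using lift[of "proj P"] Z(5) X(3) by simp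
  define u' where "u' = (\<lambda>y v. frechet_derivative X (at (Z y)) (Z' y v) \<bullet> n)"
  have dXZ: "((\<lambda>y. X (Z y)) has_derivative (\<lambda>v. frechet_derivative X (at (Z y)) (Z' y v))) (at y)"
    if "y \<in> V" for y
    by (rule has_derivative_compose[where g = X, OF dZ[rule_format, OF that]]) (use dX(1) ZU(1)[OF that] Z(2) in blast)
  have du: "(u has_derivative u' y) (at y)" if "y \<in> V" for y
    unfolding u_def u'_def by (rule has_derivative_inner_left[OF dXZ[OF that]])
  have "N (lift u y) \<bullet> (u' y v *\<^sub>R n + v$1 *\<^sub>R e + v$2 *\<^sub>R f) = 0" if y: "y \<in> V" for y v
  proof -
    have "((\<lambda>y. X (Z y)) has_derivative (\<lambda>v. u' y v *\<^sub>R n + v$1 *\<^sub>R e + v$2 *\<^sub>R f)) (at y)"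
      by (rule has_derivative_transform_within_open[OF lift_has_derivative[OF du[OF y]] Z(4) y lift])
    from has_derivative_unique[OF this dXZ[OF y]]
    have "u' y v *\<^sub>R n + v$1 *\<^sub>R e + v$2 *\<^sub>R f = frechet_derivative X (at (Z y)) (Z' y v)"
      by (rule fun_cong)
    then show ?thesis using perp[of "Z y"] ZU(1)[OF y] Z(2) lift[OF y] by auto
  qed
  then show ?thesis using that[of V u u'] Z(4,5) X(3) P o du by blast
qed

definition slope1 :: "real^3 \<Rightarrow> real" where "slope1 P = - (N P \<bullet> e) / (N P \<bullet> n)"
definition slope2 :: "real^3 \<Rightarrow> real" where "slope2 P = - (N P \<bullet> f) / (N P \<bullet> n)"

text \<open>Bootstrapping: the gradient of \<open>u\<close> is a smooth function of the normal along
  the graph, so if \<open>u\<close> is of class C^k then so is its gradient, and \<open>u\<close> is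
  of class C^(k+1). This needs no higher regularity of the local inverse.\<close>

lemma smooth_graph:
  assumes "P \<in> S"
  obtains V u where "open V" "proj P \<in> V" "lift u (proj P) = P" "openin (top_of_set S) (lift u ` V)"
    "smooth_on V u" "\<forall>y\<in>V. grad_at u y (slope1 (lift u y)) (slope2 (lift u y))"
proof -
  obtain V u u' where V: "open V" "proj P \<in> V" "lift u (proj P) = P" "openin (top_of_set S) (lift u ` V)"
    and du': "\<forall>y\<in>V. (u has_derivative u' y) (at y)"
    and perp': "\<forall>y\<in>V. \<forall>v. N (lift u y) \<bullet> (u' y v *\<^sub>R n + v$1 *\<^sub>R e + v$2 *\<^sub>R f) = 0"
    using differentiable_graph[OF assms] .
  note du = du'[rule_format] and perp = perp'[rule_format]
  have S: "lift u y \<in> S" if "y \<in> V" for y using V(4) that openin_imp_subset by blast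
  have grad: "grad_at u y (slope1 (lift u y)) (slope2 (lift u y))" if y: "y \<in> V" for y
  proof -
    have "u' y v = v$1 * slope1 (lift u y) + v$2 * slope2 (lift u y)" for v
    proof -
      have "u' y v * (N (lift u y) \<bullet> n) + v$1 * (N (lift u y) \<bullet> e) + v$2 * (N (lift u y) \<bullet> f) = 0"
        using perp[OF y, of v] by (simp only: inner_add_right inner_scaleR_right)
      moreover have "N (lift u y) \<bullet> n \<noteq> 0" using transversal[OF S[OF y]] by simp
      ultimately show ?thesis unfolding slope1_def slope2_def by (simp add: field_simps)
    qed
    then show ?thesis
      unfolding grad_at_def by (intro has_derivative_eq_rhs[OF du[OF y]] ext)
  qed
  obtain W F where W: "open W" "P \<in> W" "smooth_on W F" "\<forall>q\<in>S \<inter> W. F q = N q"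
    using gauss assms unfolding gauss_map_def smooth_on_surface_def by blast
  have F: "Ck_on k W F" for k using W(3) by (simp add: smooth_on_def)
  \<comment> \<open>Away from the surface the extension \<open>F\<close> of \<open>N\<close> need
    not be transversal to \<open>n\<close>; shrinking its domain keeps the quotients smooth.\<close>
  define W' where "W' = {x \<in> W. F x \<bullet> n > 0}"
  have W'W: "W' \<subseteq> W" by (auto simp: W'_def)
  have "continuous_on W (\<lambda>x. F x \<bullet> n)"
    by (intro continuous_on_inner continuous_on_const) (use F[of 0] in simp)
  then have "open (W \<inter> (\<lambda>x. F x \<bullet> n) -` {0<..})"
    by (rule continuous_open_preimage[OF _ W(1) open_greaterThan])
  moreover have "W \<inter> (\<lambda>x. F x \<bullet> n) -` {0<..} = W'" by (auto simp: W'_def)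
  ultimately have oW': "open W'" by simp
  have contu: "continuous_on V u"
    unfolding continuous_on_eq_continuous_at[OF V(1)]
    by (intro ballI has_derivative_continuous[OF du])
  define V' where "V' = V \<inter> lift u -` W'"
  have oV': "open V'"
    unfolding V'_def by (rule continuous_open_preimage[OF lift_continuous[OF contu] V(1) oW'])
  have "P \<in> W'" using W assms transversal by (auto simp: W'_def)
  then have P: "proj P \<in> V'" using V by (simp add: V'_def)
  have "lift u ` V' = lift u ` V \<inter> W'" by (auto simp: V'_def)
  then have o: "openin (top_of_set S) (lift u ` V')"
    using openin_Int_open[OF V(4) oW'] by simp
  have comp: "Ck_on k W' (\<lambda>x. (- (F x \<bullet> a)) *\<^sub>R inverse (F x \<bullet> n))" for a k
  proof (rule Ck_on_scaleR[OF oW'])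
    note FW' = Ck_on_subset[OF F W'W, of k]
    show "Ck_on k W' (\<lambda>x. - (F x \<bullet> a))"
      by (rule Ck_on_bounded_linear_compose[OF oW' bounded_linear_minus[OF bounded_linear_inner_left] FW'])
    show "Ck_on k W' (\<lambda>x. inverse (F x \<bullet> n))"
      by (rule Ck_on_inverse[OF oW' Ck_on_bounded_linear_compose[OF oW' bounded_linear_inner_left FW']])
        (auto simp: W'_def)
  qed
  have slopes: "slope1 (lift u y) = (- (F (lift u y) \<bullet> e)) *\<^sub>R inverse (F (lift u y) \<bullet> n)"
    "slope2 (lift u y) = (- (F (lift u y) \<bullet> f)) *\<^sub>R inverse (F (lift u y) \<bullet> n)" if "y \<in> V'" for y
  proof -
    have "F (lift u y) = N (lift u y)" using that S W'W W(4) by (auto simp: V'_def)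
    then show "slope1 (lift u y) = (- (F (lift u y) \<bullet> e)) *\<^sub>R inverse (F (lift u y) \<bullet> n)"
      "slope2 (lift u y) = (- (F (lift u y) \<bullet> f)) *\<^sub>R inverse (F (lift u y) \<bullet> n)"
      by (simp_all add: slope1_def slope2_def divide_inverse)
  qed
  have "Ck_on k V' u" for k
  proof (induction k)
    case 0
    then show ?case using continuous_on_subset[OF contu] by (auto simp: V'_def)
  next
    case (Suc k)
    show ?case
    proof (rule Ck_on_SucI[OF oV'])
      fix y assume "y \<in> V'"
      then show "(u has_derivative (\<lambda>v. v$1 *\<^sub>R slope1 (lift u y) + v$2 *\<^sub>R slope2 (lift u y))) (at y)"
        using grad[of y] by (simp add: V'_def grad_at_def)
    next
      fix v
      have "Ck_on k V' (\<lambda>y. v$1 *\<^sub>R ((- (F (lift u y) \<bullet> e)) *\<^sub>R inverse (F (lift u y) \<bullet> n))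
          + v$2 *\<^sub>R ((- (F (lift u y) \<bullet> f)) *\<^sub>R inverse (F (lift u y) \<bullet> n)))"
      proof -
        have "lift u ` V' \<subseteq> W'" by (auto simp: V'_def)
        note c = Ck_on_compose[OF oV' oW' this Ck_on_lift[OF oV' Suc.IH] comp]
        show ?thesis
          by (rule Ck_on_add[OF oV' Ck_on_scaleR[OF oV' Ck_on_const c] Ck_on_scaleR[OF oV' Ck_on_const c]])
      qed
      then show "Ck_on k V' (\<lambda>y. v$1 *\<^sub>R slope1 (lift u y) + v$2 *\<^sub>R slope2 (lift u y))"
        by (rule Ck_on_cong[OF oV', THEN iffD1, rotated]) (simp add: slopes)
    qed
  qed
  then have "smooth_on V' u" by (simp add: smooth_on_def)
  then show ?thesis using that[OF oV' P V(3) o] grad by (simp add: V'_def)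
qed

end

section \<open>Gauss map and curvatures in graph coordinates\<close>

context transversal_surface
begin

lemma N_slopes:
  assumes "P \<in> S"
  shows "N P \<bullet> e = - slope1 P * (N P \<bullet> n)" "N P \<bullet> f = - slope2 P * (N P \<bullet> n)"
    and "(N P \<bullet> n)\<^sup>2 * (1 + (slope1 P)\<^sup>2 + (slope2 P)\<^sup>2) = 1"
proof -
  have nz: "N P \<bullet> n \<noteq> 0" using transversal[OF assms] by simp
  show 1: "N P \<bullet> e = - slope1 P * (N P \<bullet> n)" "N P \<bullet> f = - slope2 P * (N P \<bullet> n)"
    using nz by (simp_all add: slope1_def slope2_def)
  have "N P \<bullet> N P = 1" using norm_N[OF assms] by (simp add: norm_eq_1)
  moreover have "N P \<bullet> N P = (N P \<bullet> n)\<^sup>2 + (N P \<bullet> e)\<^sup>2 + (N P \<bullet> f)\<^sup>2"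
    by (subst (2) frame_expand[of "N P"]) (simp add: inner_add_right power2_eq_square)
  ultimately show "(N P \<bullet> n)\<^sup>2 * (1 + (slope1 P)\<^sup>2 + (slope2 P)\<^sup>2) = 1"
    unfolding 1 by (simp add: power2_eq_square algebra_simps)
qed

lemma N_determined_by_slopes:
  assumes "P \<in> S" "Q \<in> S" "slope1 P = slope1 Q" "slope2 P = slope2 Q"
  shows "N P = N Q"
proof -
  have "(N P \<bullet> n)\<^sup>2 * (1 + (slope1 Q)\<^sup>2 + (slope2 Q)\<^sup>2) = (N Q \<bullet> n)\<^sup>2 * (1 + (slope1 Q)\<^sup>2 + (slope2 Q)\<^sup>2)"
    using N_slopes(3)[OF assms(1)] N_slopes(3)[OF assms(2)] assms(3,4) by simp
  moreover have "1 + (slope1 Q)\<^sup>2 + (slope2 Q)\<^sup>2 \<noteq> 0"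
    by (smt (verit) zero_le_power2)
  ultimately have "(N P \<bullet> n)\<^sup>2 = (N Q \<bullet> n)\<^sup>2" by simp
  then have n: "N P \<bullet> n = N Q \<bullet> n"
    using transversal[OF assms(1)] transversal[OF assms(2)] by (simp add: power2_eq_iff)
  show ?thesis
    using frame_expand[of "N P"] frame_expand[of "N Q"] N_slopes(1,2)[OF assms(1)]
      N_slopes(1,2)[OF assms(2)] assms(3,4) n by simp
qed

text \<open>With \<open>X\<close> and \<open>Y\<close> the coordinate tangent vectors,
  differentiating the identities that \<open>N\<close> is orthogonal to both and of unit length
  gives the second fundamental form as \<open>N P \<bullet> n\<close> times the Hessian, and shows
  that the shape operator has tangent values on them.\<close>

lemma graph_curvatures:
  assumes V: "open V" "y \<in> V" and S: "\<And>z. z \<in> V \<Longrightarrow> lift u z \<in> S"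
    and du: "grad_at u y (p y) (q y)"
    and p: "\<And>z. z \<in> V \<Longrightarrow> p z = slope1 (lift u z)" and q: "\<And>z. z \<in> V \<Longrightarrow> q z = slope2 (lift u z)"
    and dp: "grad_at p y a b" and dq: "grad_at q y b c"
  defines "P \<equiv> lift u y" and "w \<equiv> 1 + (p y)\<^sup>2 + (q y)\<^sup>2"
  shows "w * mean_curvature S N P = (N P \<bullet> n) * ((1 + (q y)\<^sup>2) * a - 2 * p y * q y * b + (1 + (p y)\<^sup>2) * c)"
    and "w * gauss_curvature S N P = (N P \<bullet> n)\<^sup>2 * (a * c - b\<^sup>2)"
    and "mean_curvature_vector S N P = mean_curvature S N P *\<^sub>R N P"
proof -
  have PS: "P \<in> S" using S V by (simp add: P_def)
  define D where "D = frechet_derivative N (at P within S)"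
  define G where "G = (\<lambda>v::real^2. (v$1 * p y + v$2 * q y) *\<^sub>R n + v$1 *\<^sub>R e + v$2 *\<^sub>R f)"
  have dlift: "(lift u has_derivative G) (at y)"
    unfolding G_def by (rule lift_has_derivative[OF du[unfolded grad_at_def]])
  have aty: "at y within V = at y" using at_within_open[OF V(2,1)] .
  have "(N has_derivative D) (at (lift u y) within lift u ` V)"
    unfolding D_def P_def[symmetric]
    by (rule has_derivative_subset[OF N_has_derivative[OF PS]]) (use S in blast)
  with dlift have dN: "((\<lambda>z. N (lift u z)) has_derivative (\<lambda>v. D (G v))) (at y)"
    using has_derivative_in_compose[of "lift u" G y V N D] unfolding aty by blast
  have zero: "L v = 0" if "(h has_derivative L) (at y)" "\<And>z. z \<in> V \<Longrightarrow> h z = 0" for h :: "real^2 \<Rightarrow> real" and L v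
  proof -
    have "((\<lambda>z. 0) has_derivative L) (at y)"
      by (rule has_derivative_transform_within_open[OF that(1) V]) (rule that(2))
    from has_derivative_unique[OF this has_derivative_const] show ?thesis by (rule fun_cong)
  qed
  define X where "X = p y *\<^sub>R n + e"
  define Y where "Y = q y *\<^sub>R n + f"
  have DX: "D (G v) \<bullet> X = - (N P \<bullet> n) * (v$1 * a + v$2 * b)" for v
  proof -
    \<comment> \<open>By the definition of the slope this function vanishes on the whole graph, not
      only at the point, so its derivative vanishes.\<close>
    have "((\<lambda>z. N (lift u z) \<bullet> (p z *\<^sub>R n + e)) has_derivative
        (\<lambda>v. N (lift u y) \<bullet> ((v$1 * a + v$2 * b) *\<^sub>R n + 0) + D (G v) \<bullet> (p y *\<^sub>R n + e))) (at y)"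
      by (intro has_derivative_inner dN has_derivative_add has_derivative_const has_derivative_scaleR_left
          dp[unfolded grad_at_def])
    from zero[OF this, of v] show ?thesis
      using N_slopes(1)[OF S] p by (simp add: inner_simps X_def P_def algebra_simps)
  qed
  have DY: "D (G v) \<bullet> Y = - (N P \<bullet> n) * (v$1 * b + v$2 * c)" for v
  proof -
    have "((\<lambda>z. N (lift u z) \<bullet> (q z *\<^sub>R n + f)) has_derivative
        (\<lambda>v. N (lift u y) \<bullet> ((v$1 * b + v$2 * c) *\<^sub>R n + 0) + D (G v) \<bullet> (q y *\<^sub>R n + f))) (at y)"
      by (intro has_derivative_inner dN has_derivative_add has_derivative_const has_derivative_scaleR_left
          dq[unfolded grad_at_def])
    from zero[OF this, of v] show ?thesis
      using N_slopes(2)[OF S] q by (simp add: inner_simps Y_def P_def algebra_simps)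
  qed
  have DN: "N P \<bullet> D (G v) = 0" for v
  proof -
    have "((\<lambda>z. N (lift u z) \<bullet> N (lift u z) - 1) has_derivative
        (\<lambda>v. N (lift u y) \<bullet> D (G v) + D (G v) \<bullet> N (lift u y) - 0)) (at y)"
      by (intro has_derivative_inner dN has_derivative_diff has_derivative_const)
    from zero[OF this, of v] show ?thesis
      using norm_N[OF S] by (simp add: norm_eq_1 P_def inner_commute)
  qed
  have G: "G (axis 1 1) = X" "G (axis 2 1) = Y" by (simp_all add: G_def X_def Y_def axis_def)
  have A: "shape_operator S N P v = - D v" for v by (simp add: shape_operator_def D_def)
  have NX: "N P \<bullet> X = 0" "N P \<bullet> Y = 0"
    using N_slopes(1,2)[OF PS] p[OF V(2)] q[OF V(2)]
    by (simp_all add: X_def Y_def P_def inner_simps)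
  have g: "X \<bullet> X = 1 + (p y)\<^sup>2" "Y \<bullet> Y = 1 + (q y)\<^sup>2" "X \<bullet> Y = p y * q y"
    by (simp_all add: X_def Y_def inner_simps power2_eq_square)
  have gram: "(X \<bullet> X) * (Y \<bullet> Y) - (X \<bullet> Y)\<^sup>2 = w"
    unfolding g w_def by (simp add: power2_eq_square algebra_simps)
  have w: "w > 0" unfolding w_def by (simp add: add_pos_nonneg)
  have form: "shape_operator S N P X \<bullet> X = (N P \<bullet> n) * a" "shape_operator S N P X \<bullet> Y = (N P \<bullet> n) * b"
    "shape_operator S N P Y \<bullet> X = (N P \<bullet> n) * b" "shape_operator S N P Y \<bullet> Y = (N P \<bullet> n) * c"
    unfolding A using DX[of "axis 1 1"] DX[of "axis 2 1"] DY[of "axis 1 1"] DY[of "axis 2 1"]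
    unfolding G by (simp_all add: axis_def)
  have tang: "N P \<bullet> shape_operator S N P X = 0" "N P \<bullet> shape_operator S N P Y = 0"
    unfolding A using DN[of "axis 1 1"] DN[of "axis 2 1"] unfolding G by simp_all
  note c = curvatures[OF PS NX tang form gram w]
  show "w * mean_curvature S N P = (N P \<bullet> n) * ((1 + (q y)\<^sup>2) * a - 2 * p y * q y * b + (1 + (p y)\<^sup>2) * c)"
    using c(1) unfolding g by (simp add: algebra_simps)
  show "w * gauss_curvature S N P = (N P \<bullet> n)\<^sup>2 * (a * c - b\<^sup>2)"
    using c(2) by (simp add: power2_eq_square algebra_simps)
  show "mean_curvature_vector S N P = mean_curvature S N P *\<^sub>R N P"
    by (rule c(3))
qed

lemma graph_coordinates:
  assumes "P \<in> S"
  obtains V u p q a b c a1 a2 b2 c2 where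
    "open V" "proj P \<in> V" "lift u (proj P) = P" "openin (top_of_set S) (lift u ` V)"
    "\<forall>y\<in>V. p y = slope1 (lift u y) \<and> q y = slope2 (lift u y)"
    "\<forall>y\<in>V. grad_at u y (p y) (q y) \<and> grad_at p y (a y) (b y) \<and> grad_at q y (b y) (c y) \<and>
       grad_at a y (a1 y) (a2 y) \<and> grad_at b y (a2 y) (b2 y) \<and> grad_at c y (b2 y) (c2 y)"
proof -
  obtain V u where V: "open V" "proj P \<in> V" "lift u (proj P) = P" "openin (top_of_set S) (lift u ` V)"
    and sm: "smooth_on V u" and g: "\<forall>y\<in>V. grad_at u y (slope1 (lift u y)) (slope2 (lift u y))"
    using smooth_graph[OF assms] .
  show ?thesis
  proof (rule smooth_on_third_partials[OF V(1) sm])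
    fix p q a b c a1 a2 b2 c2
    assume d: "\<And>y. y \<in> V \<Longrightarrow> grad_at u y (p y) (q y)"
      "\<And>y. y \<in> V \<Longrightarrow> grad_at p y (a y) (b y)"
      "\<And>y. y \<in> V \<Longrightarrow> grad_at q y (b y) (c y)"
      "\<And>y. y \<in> V \<Longrightarrow> grad_at a y (a1 y) (a2 y)"
      "\<And>y. y \<in> V \<Longrightarrow> grad_at b y (a2 y) (b2 y)"
      "\<And>y. y \<in> V \<Longrightarrow> grad_at c y (b2 y) (c2 y)"
    have "\<forall>y\<in>V. p y = slope1 (lift u y) \<and> q y = slope2 (lift u y)"
    proof
      fix y assume y: "y \<in> V"
      show "p y = slope1 (lift u y) \<and> q y = slope2 (lift u y)"
        using grad_at_unique[OF d(1)[OF y] g[rule_format, OF y]] by simp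
    qed
    then show thesis
      by (intro that[of V u p q a b c a1 a2 b2 c2] V) (use d in simp_all)
  qed
qed

lemma slopes_continuous: "continuous_on S slope1" "continuous_on S slope2"
proof -
  have "\<forall>P\<in>S. N P \<bullet> n \<noteq> 0" using transversal by force
  then show "continuous_on S slope1" "continuous_on S slope2"
    unfolding slope1_def slope2_def
    by (auto intro!: continuous_intros N_continuous)
qed

end

section \<open>Existence of maxima on a proper set after penalization\<close>

lemma penalized_maximum:
  fixes F :: "'a::euclidean_space \<Rightarrow> real"
  assumes "S \<noteq> {}" and proper: "\<And>K. compact K \<Longrightarrow> compact (S \<inter> K)"
    and F: "continuous_on S F" "\<And>P. P \<in> S \<Longrightarrow> F P \<le> B" and "\<delta> > 0"
  obtains P where "P \<in> S"
    "\<forall>Q\<in>S. F Q - \<delta> * sqrt (1 + Q \<bullet> Q) \<le> F P - \<delta> * sqrt (1 + P \<bullet> P)"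
proof -
  define G where "G = (\<lambda>Q. F Q - \<delta> * sqrt (1 + Q \<bullet> Q))"
  obtain P0 where P0: "P0 \<in> S" using assms(1) by blast
  \<comment> \<open>Beyond this radius the penalty alone brings the function below its value at
    \<open>P0\<close>; the maximum with \<open>norm P0\<close> keeps \<open>P0\<close> inside the
    ball.\<close>
  define R where "R = max (norm P0) ((B - G P0) / \<delta>)"
  have "compact (S \<inter> cball 0 R)" by (rule proper) simp
  moreover have "P0 \<in> S \<inter> cball 0 R" using P0 by (simp add: R_def)
  moreover have "continuous_on (S \<inter> cball 0 R) G"
    unfolding G_def by (intro continuous_intros continuous_on_subset[OF F(1)]) auto
  ultimately obtain P where P: "P \<in> S \<inter> cball 0 R" "\<And>Q. Q \<in> S \<inter> cball 0 R \<Longrightarrow> G Q \<le> G P"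
    using continuous_attains_sup[of "S \<inter> cball 0 R" G] by blast
  have "G Q \<le> G P" if Q: "Q \<in> S" for Q
  proof (cases "norm Q \<le> R")
    case True
    then show ?thesis using P(2) Q by simp
  next
    case False
    have "norm Q \<le> sqrt (1 + Q \<bullet> Q)"
      by (rule real_le_rsqrt) (simp add: power2_norm_eq_inner)
    then have "\<delta> * norm Q \<le> \<delta> * sqrt (1 + Q \<bullet> Q)" using assms(5) by simp
    moreover have "(B - G P0) / \<delta> < norm Q" using False by (simp add: R_def)
    then have "B - G P0 < \<delta> * norm Q" using assms(5) by (simp add: divide_less_eq mult.commute)
    ultimately have "G Q \<le> G P0" using F(2)[OF Q] unfolding G_def by linarith
    also have "\<dots> \<le> G P" using P(2)[OF \<open>P0 \<in> S \<inter> cball 0 R\<close>] .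
    finally show ?thesis .
  qed
  then show ?thesis using that[of P] P(1) unfolding G_def by blast
qed


subsection \<open>Vanishing of the mean curvature and flatness\<close>

lemma smooth_on_deriv:
  fixes g :: "real \<Rightarrow> real"
  assumes "smooth_on UNIV g"
  shows "(g has_real_derivative deriv g x) (at x)" "smooth_on UNIV (deriv g)"
proof -
  have d: "(g has_derivative frechet_derivative g (at x)) (at x)" for x
    by (rule Ck_on_has_derivative[OF _ open_UNIV UNIV_I, of 0]) (use assms in \<open>simp only: smooth_on_def\<close>)
  have r: "(g has_real_derivative frechet_derivative g (at x) 1) (at x)" for x
  proof -
    have "frechet_derivative g (at x) = (\<lambda>h. frechet_derivative g (at x) 1 * h)"
    proof
      fix h
      show "frechet_derivative g (at x) h = frechet_derivative g (at x) 1 * h"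
        using linear_cmul[OF has_derivative_linear[OF d[of x]], of h 1] by simp
    qed
    then show ?thesis unfolding has_field_derivative_def by (rule has_derivative_eq_rhs[OF d])
  qed
  have e: "deriv g = (\<lambda>x. frechet_derivative g (at x) 1)"
    using DERIV_imp_deriv[OF r] by (rule ext)
  show "(g has_real_derivative deriv g x) (at x)" unfolding e by (rule r)
  show "smooth_on UNIV (deriv g)" unfolding e smooth_on_def
  proof
    fix k show "Ck_on k UNIV (\<lambda>x. frechet_derivative g (at x) 1)"
      using assms[unfolded smooth_on_def, rule_format, of "Suc k"] by simp
  qed
qed

text \<open>A convergent sequence together with its limit is compact, so its trace on
  \<open>S\<close> is closed and contains the limit.\<close>

lemma closed_if_proper:
  fixes S :: "'a::euclidean_space set"
  assumes "\<And>K. compact K \<Longrightarrow> compact (S \<inter> K)"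
  shows "closed S"
  unfolding closed_sequential_limits
proof (intro allI impI)
  fix X l assume X: "(\<forall>n. X n \<in> S) \<and> X \<longlonglongrightarrow> l"
  then have "closed (S \<inter> insert l (range X))"
    using assms compact_sequence_with_limit compact_imp_closed by blast
  then have "l \<in> S \<inter> insert l (range X)"
    using X unfolding closed_sequential_limits by blast
  then show "l \<in> S" by blast
qed

text \<open>In the application \<open>m\<close> is the derivative of the weight exponent and
  \<open>f\<close> the vertical direction. \<open>B\<close> encodes the uniform transversality and
  \<open>M\<close> the bound on the mean curvature.\<close>

locale bounded_slope_minimal_surface = transversal_surface +
  fixes m m1 m2 :: "real \<Rightarrow> real" and B M :: real
  assumes proper: "compact K \<Longrightarrow> compact (S \<inter> K)"
    and dm: "(m has_real_derivative m1 t) (at t)"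
    and dm1: "(m1 has_real_derivative m2 t) (at t)"
    and m1_nonpos: "m1 t \<le> 0"
    and m_m2_nonneg: "m t * m2 t \<ge> 0"
    and minimal: "P \<in> S \<Longrightarrow> mean_curvature_vector S N P = m (P \<bullet> f) *\<^sub>R ((f \<bullet> N P) *\<^sub>R N P)"
    and H_bounded: "P \<in> S \<Longrightarrow> \<bar>mean_curvature S N P\<bar> \<le> M"
    and K_nonneg: "P \<in> S \<Longrightarrow> gauss_curvature S N P \<ge> 0"
    and slopes_bounded: "P \<in> S \<Longrightarrow> 1 + (slope1 P)\<^sup>2 + (slope2 P)\<^sup>2 \<le> B"
begin

lemma local_graph_equation:
  assumes "P \<in> S"
  obtains V u p q a b c a1 a2 b2 c2 where
    "graph_equation V u p q a b c a1 a2 b2 c2 m m1 m2"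
    "proj P \<in> V" "lift u (proj P) = P" "openin (top_of_set S) (lift u ` V)"
    "\<forall>y\<in>V. p y = slope1 (lift u y) \<and> q y = slope2 (lift u y)"
    "\<forall>y\<in>V. mean_curvature S N (lift u y) = - (m (y$2) * q y) * (N (lift u y) \<bullet> n)"
proof -
  obtain V u p q a b c a1 a2 b2 c2 where
    V: "open V" "proj P \<in> V" "lift u (proj P) = P" "openin (top_of_set S) (lift u ` V)"
    and pq: "\<forall>y\<in>V. p y = slope1 (lift u y) \<and> q y = slope2 (lift u y)"
    and d: "\<forall>y\<in>V. grad_at u y (p y) (q y) \<and> grad_at p y (a y) (b y) \<and> grad_at q y (b y) (c y) \<and>
       grad_at a y (a1 y) (a2 y) \<and> grad_at b y (a2 y) (b2 y) \<and> grad_at c y (b2 y) (c2 y)"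
    using graph_coordinates[OF assms] .
  have S: "lift u y \<in> S" if "y \<in> V" for y using V(4) that openin_imp_subset by blast
  have H: "mean_curvature S N (lift u y) = - (m (y$2) * q y) * (N (lift u y) \<bullet> n)"
    and E: "(1 + (q y)\<^sup>2) * a y - 2 * p y * q y * b y + (1 + (p y)\<^sup>2) * c y
      = - (m (y$2) * q y) * (1 + (p y)\<^sup>2 + (q y)\<^sup>2)"
    and D: "a y * c y - (b y)\<^sup>2 \<ge> 0" if y: "y \<in> V" for y
  proof -
    note dy = d[rule_format, OF y]
    have curv: "(1 + (p y)\<^sup>2 + (q y)\<^sup>2) * mean_curvature S N (lift u y) =
        (N (lift u y) \<bullet> n) * ((1 + (q y)\<^sup>2) * a y - 2 * p y * q y * b y + (1 + (p y)\<^sup>2) * c y)"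
      "(1 + (p y)\<^sup>2 + (q y)\<^sup>2) * gauss_curvature S N (lift u y) = (N (lift u y) \<bullet> n)\<^sup>2 * (a y * c y - (b y)\<^sup>2)"
      "mean_curvature_vector S N (lift u y) = mean_curvature S N (lift u y) *\<^sub>R N (lift u y)"
      by (rule graph_curvatures[OF V(1) y, of u p q]; use S dy pq in auto)+
    have nu: "N (lift u y) \<bullet> n > 0" by (rule transversal[OF S[OF y]])
    have w: "1 + (p y)\<^sup>2 + (q y)\<^sup>2 > 0" by (simp add: add_pos_nonneg)
    have "N (lift u y) \<noteq> 0" using nu by auto
    then have "mean_curvature S N (lift u y) = m (y$2) * (N (lift u y) \<bullet> f)"
      using minimal[OF S[OF y]] unfolding curv(3) by (simp add: inner_commute[of f "N (lift u y)"])
    also have "\<dots> = - (m (y$2) * q y) * (N (lift u y) \<bullet> n)"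
      using N_slopes(2)[OF S[OF y]] pq y by simp
    finally show H: "mean_curvature S N (lift u y) = - (m (y$2) * q y) * (N (lift u y) \<bullet> n)" .
    have "(N (lift u y) \<bullet> n) * ((1 + (q y)\<^sup>2) * a y - 2 * p y * q y * b y + (1 + (p y)\<^sup>2) * c y)
       = (N (lift u y) \<bullet> n) * (- (m (y$2) * q y) * (1 + (p y)\<^sup>2 + (q y)\<^sup>2))"
      unfolding curv(1)[symmetric] H by (simp add: algebra_simps)
    then show "(1 + (q y)\<^sup>2) * a y - 2 * p y * q y * b y + (1 + (p y)\<^sup>2) * c y
      = - (m (y$2) * q y) * (1 + (p y)\<^sup>2 + (q y)\<^sup>2)"
      using nu by (metis mult_left_cancel less_irrefl)
    have "(N (lift u y) \<bullet> n)\<^sup>2 * (a y * c y - (b y)\<^sup>2) \<ge> 0"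
      unfolding curv(2)[symmetric] using K_nonneg[OF S[OF y]] w by (intro mult_nonneg_nonneg) auto
    then show "a y * c y - (b y)\<^sup>2 \<ge> 0"
      using nu by (simp add: zero_le_mult_iff)
  qed
  have "graph_equation V u p q a b c a1 a2 b2 c2 m m1 m2"
    by unfold_locales (use V(1) d dm dm1 E D m1_nonpos m_m2_nonneg in auto)
  then show ?thesis using that V(2-4) pq H by blast
qed

lemma speed_eq:
  assumes "P \<in> S"
  shows "mean_curvature S N P = - (m (P \<bullet> f) * slope2 P) * (N P \<bullet> n)"
proof -
  obtain V u p q a b c a1 a2 b2 c2 where
    "graph_equation V u p q a b c a1 a2 b2 c2 m m1 m2"
    "proj P \<in> V" "lift u (proj P) = P" "openin (top_of_set S) (lift u ` V)"
    "\<forall>y\<in>V. p y = slope1 (lift u y) \<and> q y = slope2 (lift u y)"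
    "\<forall>y\<in>V. mean_curvature S N (lift u y) = - (m (y$2) * q y) * (N (lift u y) \<bullet> n)"
    using local_graph_equation[OF assms] .
  then show ?thesis by force
qed

text \<open>The mean curvature is the speed times \<open>N P \<bullet> n\<close> up to sign, and the
  slope bound keeps this factor at least 1 / \<open>B\<close>.\<close>

lemma speed_bounded:
  assumes P: "P \<in> S" shows "\<bar>m (P \<bullet> f) * slope2 P\<bar> \<le> M * B"
proof -
  define \<nu> where "\<nu> = N P \<bullet> n"
  have \<nu>: "\<nu> > 0" using transversal[OF P] by (simp add: \<nu>_def)
  have M: "\<bar>m (P \<bullet> f) * slope2 P\<bar> * \<nu> \<le> M"
    using H_bounded[OF P] \<nu> unfolding speed_eq[OF P] \<nu>_def[symmetric] by (simp add: abs_mult)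
  have "\<nu>\<^sup>2 * (1 + (slope1 P)\<^sup>2 + (slope2 P)\<^sup>2) \<le> \<nu>\<^sup>2 * B"
    using slopes_bounded[OF P] by (intro mult_left_mono) auto
  then have B: "1 \<le> \<nu>\<^sup>2 * B" using N_slopes(3)[OF P] by (simp add: \<nu>_def)
  have B1: "B \<ge> 1" using slopes_bounded[OF P] by (smt (verit) zero_le_power2)
  have "\<nu> \<le> 1"
    using norm_cauchy_schwarz[of "N P" n] norm_N[OF P] norms by (simp add: \<nu>_def)
  then have "\<nu>\<^sup>2 \<le> \<nu>" using \<nu> by (simp add: power2_eq_square)
  then have "\<nu>\<^sup>2 * B \<le> \<nu> * B" using B1 by (intro mult_right_mono) auto
  then have "1 \<le> \<nu> * B" using B by linarith
  then have "\<bar>m (P \<bullet> f) * slope2 P\<bar> * 1 \<le> \<bar>m (P \<bullet> f) * slope2 P\<bar> * (\<nu> * B)"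
    by (rule mult_left_mono) simp
  also have "\<dots> = \<bar>m (P \<bullet> f) * slope2 P\<bar> * \<nu> * B" by simp
  also have "\<dots> \<le> M * B" using M B1 by (intro mult_right_mono) auto
  finally show ?thesis by simp
qed

text \<open>The slope term has weight \<eta> and the radius weight \<eta>^2. At the maximum this
  bounds the squared speed by \<eta> K / 2, and comparing with any \<open>Q\<close> costs at most
  \<eta> \<open>B\<close> for the slopes plus the penalty at \<open>Q\<close>. The constant must
  precede \<eta> and \<open>Q\<close>, so that \<eta> can tend to 0 at a fixed
  \<open>Q\<close>.\<close>

lemma penalized_speed_bound:
  "\<exists>C. \<forall>\<eta> Q. 0 < \<eta> \<longrightarrow> \<eta> \<le> 1 \<longrightarrow> Q \<in> S \<longrightarrow>
    (m (Q \<bullet> f) * slope2 Q)\<^sup>2 \<le> \<eta> * (C + sqrt (1 + Q \<bullet> Q))"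
proof -
  \<comment> \<open>The constant depends on \<open>m\<close> and the two bounds but not on a chart,
    so it serves for every maximum point, although that point moves with \<eta>.\<close>
  define K where "K = graph_equation.radius_bound m B (M * B)"
  have "(m (Q \<bullet> f) * slope2 Q)\<^sup>2 \<le> \<eta> * (K / 2 + B + sqrt (1 + Q \<bullet> Q))"
    if \<eta>: "0 < \<eta>" "\<eta> \<le> 1" and Q: "Q \<in> S" for \<eta> Q
  proof -
    define F where "F = (\<lambda>P. (m (P \<bullet> f) * slope2 P) * (m (P \<bullet> f) * slope2 P)
      + \<eta> * (slope1 P * slope1 P + slope2 P * slope2 P))"
    have sl: "slope1 P * slope1 P + slope2 P * slope2 P \<le> B" if "P \<in> S" for P
      using slopes_bounded[OF that] by (simp add: power2_eq_square)
    have Fb: "F P \<le> (M * B) * (M * B) + B" if P: "P \<in> S" for P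
    proof -
      have "\<bar>m (P \<bullet> f) * slope2 P\<bar> * \<bar>m (P \<bullet> f) * slope2 P\<bar> \<le> (M * B) * (M * B)"
        using speed_bounded[OF P] by (intro mult_mono) auto
      moreover have "\<eta> * (slope1 P * slope1 P + slope2 P * slope2 P) \<le> 1 * B"
        using sl[OF P] \<eta> by (intro mult_mono) auto
      ultimately show ?thesis unfolding F_def by (simp only: abs_mult_self_eq)
    qed
    have Fc: "continuous_on S F"
    proof -
      have "continuous_on S (\<lambda>P. m (P \<bullet> f))"
      proof (rule continuous_on_compose2[of UNIV m])
        show "continuous_on UNIV m"
          by (rule DERIV_continuous_on[where D = m1]) (simp add: dm)
      qed (auto intro: continuous_intros)
      then show ?thesis unfolding F_def by (intro continuous_intros slopes_continuous)
    qed
    have "S \<noteq> {}" "\<eta>\<^sup>2 > 0" using Q \<eta>(1) by auto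
    then obtain P where P: "P \<in> S"
      "\<forall>Q\<in>S. F Q - \<eta>\<^sup>2 * sqrt (1 + Q \<bullet> Q) \<le> F P - \<eta>\<^sup>2 * sqrt (1 + P \<bullet> P)"
      using penalized_maximum[OF _ proper Fc Fb] by metis
    obtain V u p q a b c a1 a2 b2 c2 where
      "graph_equation V u p q a b c a1 a2 b2 c2 m m1 m2"
      and V: "proj P \<in> V" "lift u (proj P) = P" "openin (top_of_set S) (lift u ` V)"
      and pq: "\<forall>y\<in>V. p y = slope1 (lift u y) \<and> q y = slope2 (lift u y)"
      and "\<forall>y\<in>V. mean_curvature S N (lift u y) = - (m (y$2) * q y) * (N (lift u y) \<bullet> n)"
      using local_graph_equation[OF P(1)] .
    interpret graph_equation V u p q a b c a1 a2 b2 c2 m m1 m2 by fact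
    have S: "lift u y \<in> S" if "y \<in> V" for y using V(3) that openin_imp_subset by blast
    define G where "G = (\<lambda>y. (m (y$2) * q y) * (m (y$2) * q y) + \<eta> * (p y * p y + q y * q y)
      + (- \<eta>\<^sup>2) * sqrt (1 + u y * u y + y$1 * y$1 + y$2 * y$2))"
    have nrm: "lift u y \<bullet> lift u y = u y * u y + y$1 * y$1 + y$2 * y$2" for y
      unfolding lift_def by (simp add: inner_simps)
    have G: "G y = F (lift u y) - \<eta>\<^sup>2 * sqrt (1 + lift u y \<bullet> lift u y)" if "y \<in> V" for y
      unfolding G_def F_def nrm using pq that by (simp add: add.assoc)
    have sP: "p (proj P) = slope1 P" "q (proj P) = slope2 P" using pq V by auto
    have "2 * \<eta> * (m (proj P $ 2) * q (proj P))\<^sup>2 \<le> \<eta>\<^sup>2 * radius_bound B (M * B)"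
    proof (rule speed_bound_at_max[OF V(1), where G = G])
      show "1 + (p (proj P))\<^sup>2 + (q (proj P))\<^sup>2 \<le> B" using slopes_bounded[OF P(1)] sP by simp
      show "\<bar>m (proj P $ 2) * q (proj P)\<bar> \<le> M * B" using speed_bounded[OF P(1)] sP by simp
      show "G y = (m (y$2) * q y) * (m (y$2) * q y) + \<eta> * (p y * p y + q y * q y)
        + (- \<eta>\<^sup>2) * sqrt (1 + u y * u y + y$1 * y$1 + y$2 * y$2)" for y unfolding G_def ..
      show "G y \<le> G (proj P)" if "y \<in> V" for y
        unfolding G[OF that] G[OF V(1)] V(2) by (rule P(2)[rule_format, OF S[OF that]])
    qed (use \<eta> in auto)
    then have "\<eta> * (2 * (m (P \<bullet> f) * slope2 P)\<^sup>2) \<le> \<eta> * (\<eta> * K)"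
      unfolding K_def sP by (simp add: power2_eq_square algebra_simps)
    then have hP: "(m (P \<bullet> f) * slope2 P)\<^sup>2 \<le> \<eta> * K / 2" using \<eta>(1) by simp
    have "\<eta> * (slope1 P * slope1 P + slope2 P * slope2 P) \<le> \<eta> * B"
      using sl[OF P(1)] \<eta> by (intro mult_left_mono) auto
    moreover have "0 \<le> \<eta> * (slope1 Q * slope1 Q + slope2 Q * slope2 Q)" using \<eta> by simp
    moreover have "0 \<le> \<eta>\<^sup>2 * sqrt (1 + P \<bullet> P)" by (simp add: add_nonneg_nonneg)
    \<comment> \<open>Here \<eta> \<le> 1 is used to replace \<eta>^2 by \<eta>, so that all terms
      share one factor.\<close>
    moreover have "\<eta>\<^sup>2 * sqrt (1 + Q \<bullet> Q) \<le> \<eta> * sqrt (1 + Q \<bullet> Q)"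
      using \<eta> by (intro mult_right_mono) (auto simp: power2_eq_square add_nonneg_nonneg)
    ultimately have "(m (Q \<bullet> f) * slope2 Q)\<^sup>2 \<le> \<eta> * K / 2 + \<eta> * B + \<eta> * sqrt (1 + Q \<bullet> Q)"
      using P(2)[rule_format, OF Q] hP unfolding F_def power2_eq_square[symmetric] by linarith
    then show ?thesis by (simp add: algebra_simps)
  qed
  then show ?thesis by (intro exI[of _ "K / 2 + B"] allI impI)
qed

lemma speed_zero:
  assumes Q: "Q \<in> S" shows "m (Q \<bullet> f) * slope2 Q = 0"
proof (rule ccontr)
  assume ne: "m (Q \<bullet> f) * slope2 Q \<noteq> 0"
  obtain C where C: "\<forall>\<eta> Q. 0 < \<eta> \<longrightarrow> \<eta> \<le> 1 \<longrightarrow> Q \<in> S \<longrightarrow>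
      (m (Q \<bullet> f) * slope2 Q)\<^sup>2 \<le> \<eta> * (C + sqrt (1 + Q \<bullet> Q))"
    using penalized_speed_bound ..
  define h where "h = (m (Q \<bullet> f) * slope2 Q)\<^sup>2"
  define L where "L = C + sqrt (1 + Q \<bullet> Q)"
  have h: "h > 0" unfolding h_def using ne by (simp only: zero_less_power2 not_False_eq_True)
  have le: "h \<le> \<eta> * L" if "0 < \<eta>" "\<eta> \<le> 1" for \<eta> using C[rule_format, OF that Q] by (simp add: h_def L_def)
  have L: "L > 0" using le[of 1] h by simp
  \<comment> \<open>Chosen to make \<eta> L at most h / 2, which contradicts the bound; the cap at 1
    keeps \<eta> admissible.\<close>
  define \<eta> where "\<eta> = min 1 (h / (2 * L))"
  have \<eta>: "0 < \<eta>" "\<eta> \<le> 1" using h L by (auto simp: \<eta>_def)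
  have "\<eta> * L \<le> h / (2 * L) * L" unfolding \<eta>_def using L by (intro mult_right_mono) auto
  also have "\<dots> = h / 2" using L by simp
  finally show False using le[OF \<eta>] h by simp
qed

text \<open>Zero speed makes the weighted trace of the Hessian vanish, and with a nonnegative
  determinant the whole Hessian vanishes. On a ball, which is convex, the slopes and then the normal
  are constant, so the height in the normal direction is constant too.\<close>

lemma locally_flat:
  assumes P: "P \<in> S"
  obtains d u where "d > 0" "P \<in> lift u ` ball (proj P) d" "openin (top_of_set S) (lift u ` ball (proj P) d)"
    "\<forall>Q\<in>lift u ` ball (proj P) d. N Q = N P \<and> Q \<bullet> N P = P \<bullet> N P"
proof -
  obtain V u p q a b c a1 a2 b2 c2 where
    "graph_equation V u p q a b c a1 a2 b2 c2 m m1 m2"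
    and V: "proj P \<in> V" "lift u (proj P) = P" "openin (top_of_set S) (lift u ` V)"
    and pq: "\<forall>y\<in>V. p y = slope1 (lift u y) \<and> q y = slope2 (lift u y)"
    and "\<forall>y\<in>V. mean_curvature S N (lift u y) = - (m (y$2) * q y) * (N (lift u y) \<bullet> n)"
    using local_graph_equation[OF P] .
  interpret graph_equation V u p q a b c a1 a2 b2 c2 m m1 m2 by fact
  have S: "lift u y \<in> S" if "y \<in> V" for y using V(3) that openin_imp_subset by blast
  obtain d where d: "d > 0" "ball (proj P) d \<subseteq> V" using open_V V(1) openE by blast
  have abc: "a y = 0 \<and> b y = 0 \<and> c y = 0" if y: "y \<in> V" for y
  proof -
    have "m (y$2) * q y = 0" using speed_zero[OF S[OF y]] pq y by simp
    then have "(1 + (q y)\<^sup>2) * a y - 2 * p y * q y * b y + (1 + (p y)\<^sup>2) * c y = 0"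
      using equation[OF y] by simp
    then have "(a y)\<^sup>2 + 2 * (b y)\<^sup>2 + (c y)\<^sup>2 \<le> 0"
      using hessian_trace_bound[OF det_nonneg[OF y], of "q y" "p y"] by simp
    then have "(a y)\<^sup>2 = 0" "(b y)\<^sup>2 = 0" "(c y)\<^sup>2 = 0"
      using zero_le_power2[of "a y"] zero_le_power2[of "b y"] zero_le_power2[of "c y"] by linarith+
    then show ?thesis by simp
  qed
  have const: "g y = g (proj P)" if "\<And>y. y \<in> V \<Longrightarrow> grad_at g y 0 0" "y \<in> ball (proj P) d" for g y
  proof (rule has_derivative_zero_unique[of "ball (proj P) d"])
    fix x assume "x \<in> ball (proj P) d"
    then have "grad_at g x 0 0" using that(1) d by blast
    then show "(g has_derivative (\<lambda>h. 0)) (at x within ball (proj P) d)"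
      unfolding grad_at_def by (auto intro: has_derivative_at_withinI)
  qed (use that d in auto)
  have Nc: "N (lift u y) = N P" if y: "y \<in> ball (proj P) d" for y
  proof -
    have "p y = p (proj P)" by (rule const[OF _ y]) (use dp abc in metis)
    moreover have "q y = q (proj P)" by (rule const[OF _ y]) (use dq abc in metis)
    moreover have "y \<in> V" using y d by blast
    ultimately show ?thesis
      using N_determined_by_slopes[OF S P] pq V by metis
  qed
  have "lift u y \<bullet> N P = P \<bullet> N P" if y: "y \<in> ball (proj P) d" for y
  proof -
    have "lift u y \<bullet> N P = lift u (proj P) \<bullet> N P"
    proof (rule has_derivative_zero_unique[of "ball (proj P) d" "\<lambda>y. lift u y \<bullet> N P"])
      fix x assume x: "x \<in> ball (proj P) d"
      then have xV: "x \<in> V" using d by blast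
      have s: "p x = slope1 P" "q x = slope2 P"
        using pq xV Nc[OF x] by (simp_all add: slope1_def slope2_def)
      have "((\<lambda>y. lift u y \<bullet> N P) has_derivative
          (\<lambda>v. ((v$1 * p x + v$2 * q x) *\<^sub>R n + v$1 *\<^sub>R e + v$2 *\<^sub>R f) \<bullet> N P)) (at x)"
        by (intro has_derivative_inner_left lift_has_derivative du[OF xV, unfolded grad_at_def])
      moreover have "((v$1 * p x + v$2 * q x) *\<^sub>R n + v$1 *\<^sub>R e + v$2 *\<^sub>R f) \<bullet> N P = 0" for v :: "real^2"
        using N_slopes(1,2)[OF P] unfolding s
        by (simp add: inner_add_left inner_commute[of _ "N P"] algebra_simps)
      ultimately show "((\<lambda>y. lift u y \<bullet> N P) has_derivative (\<lambda>h. 0)) (at x within ball (proj P) d)"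
        by (simp add: has_derivative_at_withinI)
    qed (use y d in auto)
    then show ?thesis using V(2) by simp
  qed
  moreover have "openin (top_of_set S) (lift u ` ball (proj P) d)"
  proof -
    have "open (proj -` ball (proj P) d)"
      by (intro open_vimage linear_continuous_on bounded_linear_proj) auto
    moreover have "lift u ` ball (proj P) d = lift u ` V \<inter> proj -` ball (proj P) d"
      using d(2) by auto
    ultimately show ?thesis using openin_Int_open[OF V(3)] by simp
  qed
  moreover have "P \<in> lift u ` ball (proj P) d"
    using V(2) d(1) by (intro image_eqI[of _ _ "proj P"]) auto
  ultimately show ?thesis using that[OF d(1), of u] Nc by blast
qed

text \<open>Local constancy on a connected surface places it in one plane \<open>H\<close>. There it
  is open, by the local graphs, and closed, by properness; as \<open>H\<close> is connected, the
  surface is all of it.\<close>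

lemma plane: "is_plane S"
proof -
  have conn: "connected S" and "S \<noteq> {}" using surface by (auto simp: embedded_surface_def)
  then obtain P0 where P0: "P0 \<in> S" by blast
  have "N constant_on S"
  proof (rule locally_constant_imp_constant[OF conn])
    fix P assume P: "P \<in> S"
    obtain d u where "d > 0" "P \<in> lift u ` ball (proj P) d" "openin (top_of_set S) (lift u ` ball (proj P) d)"
      "\<forall>Q\<in>lift u ` ball (proj P) d. N Q = N P \<and> Q \<bullet> N P = P \<bullet> N P"
      using locally_flat[OF P] .
    then show "\<exists>T. openin (top_of_set S) T \<and> P \<in> T \<and> (\<forall>x\<in>T. N x = N P)"
      by blast
  qed
  then have N: "N P = N P0" if "P \<in> S" for P
    using that P0 unfolding constant_on_def by auto
  have "(\<lambda>P. P \<bullet> N P0) constant_on S"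
  proof (rule locally_constant_imp_constant[OF conn])
    fix P assume P: "P \<in> S"
    obtain d u where "d > 0" "P \<in> lift u ` ball (proj P) d" "openin (top_of_set S) (lift u ` ball (proj P) d)"
      "\<forall>Q\<in>lift u ` ball (proj P) d. N Q = N P \<and> Q \<bullet> N P = P \<bullet> N P"
      using locally_flat[OF P] .
    then show "\<exists>T. openin (top_of_set S) T \<and> P \<in> T \<and> (\<forall>x\<in>T. x \<bullet> N P0 = P \<bullet> N P0)"
      unfolding N[OF P] by blast
  qed
  then have const: "P \<bullet> N P0 = P0 \<bullet> N P0" if "P \<in> S" for P
    using that P0 unfolding constant_on_def by auto
  define H where "H = {x. N P0 \<bullet> x = P0 \<bullet> N P0}"
  have sub: "S \<subseteq> H" using const by (auto simp: H_def inner_commute)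
  have "openin (top_of_set H) S"
  proof (subst openin_subopen, intro ballI)
    fix P assume P: "P \<in> S"
    obtain d u where d: "d > 0" "P \<in> lift u ` ball (proj P) d" "openin (top_of_set S) (lift u ` ball (proj P) d)"
      "\<forall>Q\<in>lift u ` ball (proj P) d. N Q = N P \<and> Q \<bullet> N P = P \<bullet> N P"
      using locally_flat[OF P] .
    \<comment> \<open>The point of the graph with the same projection also lies in \<open>H\<close>.
      The two differ by a multiple of \<open>n\<close>, and since \<open>n\<close> is transversal to
      \<open>H\<close> they coincide.\<close>
    have "x \<in> S" if x: "x \<in> H" "proj x \<in> ball (proj P) d" for x
    proof -
      have S: "lift u (proj x) \<in> S" using d(3) x(2) openin_imp_subset by blast
      define z where "z = x - lift u (proj x)"
      have "z \<bullet> e = 0" "z \<bullet> f = 0" by (simp_all add: z_def inner_simps)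
      then have z: "z = (z \<bullet> n) *\<^sub>R n" using frame_expand[of z] by simp
      have "N P0 \<bullet> z = 0" using x(1) sub S by (auto simp: z_def inner_simps H_def)
      then have "(z \<bullet> n) * (N P0 \<bullet> n) = 0" by (subst (asm) z) simp
      then have "z = 0" using transversal[OF P0] by (subst z) simp
      then show ?thesis using S by (simp add: z_def)
    qed
    moreover have "open (proj -` ball (proj P) d)"
      by (intro open_vimage linear_continuous_on bounded_linear_proj) auto
    ultimately show "\<exists>T. openin (top_of_set H) T \<and> P \<in> T \<and> T \<subseteq> S"
      using P sub d(1) by (intro exI[of _ "H \<inter> proj -` ball (proj P) d"]) (auto simp: openin_open_Int)
  qed
  moreover have "closedin (top_of_set H) S"
    using closed_if_proper[OF proper] sub by (simp add: closed_subset)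
  moreover have "connected H"
    unfolding H_def by (intro convex_connected convex_hyperplane)
  ultimately have "S = H" using P0 unfolding connected_clopen by blast
  moreover have "N P0 \<noteq> 0" using norm_N[OF P0] by auto
  then have "aff_dim H = 2" unfolding H_def by simp
  ultimately show ?thesis unfolding is_plane_def H_def by (simp add: affine_hyperplane)
qed

end

theorem theoremB:
  fixes \<phi> :: "real \<Rightarrow> real"
    and \<Sigma> :: "(real^3) set"
    and N :: "real^3 \<Rightarrow> real^3"
    and C \<epsilon> :: real
    and y0 :: "real^3"
  assumes "smooth_on UNIV \<phi>"
    and "mono \<phi> \<or> antimono \<phi>"
    and "\<And>x. (deriv ^^ 3) \<phi> x * deriv \<phi> x \<ge> 0"
    and "\<And>x. (deriv ^^ 2) \<phi> x \<le> 0"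
    and "properly_embedded_surface \<Sigma>"
    and "gauss_map \<Sigma> N"
    and "phi_minimal \<phi> \<Sigma> N"
    and "\<exists>M. \<forall>p\<in>\<Sigma>. \<bar>mean_curvature \<Sigma> N p\<bar> \<le> M"
    and "\<forall>p\<in>\<Sigma>. gauss_curvature \<Sigma> N p \<ge> 0"
    and "C > 0"
    and "\<exists>R. \<forall>p\<in>\<Sigma>. norm p \<ge> R \<longrightarrow> \<bar>deriv \<phi> (p \<bullet> e3)\<bar> \<le> C * norm p * ln (norm p)"
    and "\<epsilon> > 0"
    and "norm y0 = 1"
    and "y0 \<bullet> e3 = 0"
    and "\<forall>p\<in>\<Sigma>. N p \<bullet> y0 \<le> - 2 * \<epsilon>"
  shows "is_plane \<Sigma>"
proof -
  note H = assms
  \<comment> \<open>The sign of \<open>y0\<close> is reversed so that the normal has a positive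
    component along the graph direction; the cross product completes the frame with
    \<open>e3\<close> last.\<close>
  define e where "e = cross3 (- y0) e3"
  have e3: "norm e3 = 1" by (simp add: e3_def)
  have "(norm e)\<^sup>2 = 1" unfolding e_def norm_cross using H(13,14) e3 by simp
  then have e: "norm e = 1" using norm_ge_zero[of e] by (auto simp: power2_eq_1_iff)
  have nu: "N P \<bullet> - y0 \<ge> 2 * \<epsilon>" if "P \<in> \<Sigma>" for P using H(15) that by force
  interpret transversal_surface \<Sigma> N "- y0" e e3
  proof
    show "embedded_surface \<Sigma>" using H(5) by (simp add: properly_embedded_surface_def)
    show "- y0 \<bullet> e = 0" "e \<bullet> e3 = 0" unfolding e_def by (simp_all only: dot_cross_self)
    show "N P \<bullet> - y0 > 0" if "P \<in> \<Sigma>" for P using nu[OF that] H(12) by linarith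
  qed (use H(6,13,14) e e3 in auto)
  obtain M where M: "\<forall>p\<in>\<Sigma>. \<bar>mean_curvature \<Sigma> N p\<bar> \<le> M" using H(8) ..
  \<comment> \<open>The left side is the inverse square of the component of \<open>N\<close> along
    the graph direction, which is at least \<open>2 * \<epsilon>\<close>.\<close>
  have slopes: "1 + (slope1 P)\<^sup>2 + (slope2 P)\<^sup>2 \<le> 1 / (2 * \<epsilon>)\<^sup>2" if P: "P \<in> \<Sigma>" for P
  proof -
    have "(2 * \<epsilon>)\<^sup>2 \<le> (N P \<bullet> - y0)\<^sup>2" using nu[OF P] H(12) by (intro power_mono) auto
    then have "(2 * \<epsilon>)\<^sup>2 * (1 + (slope1 P)\<^sup>2 + (slope2 P)\<^sup>2) \<le>
        (N P \<bullet> - y0)\<^sup>2 * (1 + (slope1 P)\<^sup>2 + (slope2 P)\<^sup>2)"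
      by (intro mult_right_mono) auto
    also have "\<dots> = 1" by (rule N_slopes(3)[OF P])
    finally show ?thesis using H(12) by (simp add: field_simps)
  qed
  note \<phi>1 = smooth_on_deriv(2)[OF H(1)]
  note \<phi>2 = smooth_on_deriv(2)[OF \<phi>1]
  interpret bounded_slope_minimal_surface \<Sigma> N "- y0" e e3 "deriv \<phi>" "deriv (deriv \<phi>)"
    "deriv (deriv (deriv \<phi>))" "1 / (2 * \<epsilon>)\<^sup>2" M
  proof
    fix t
    show "(deriv \<phi> has_real_derivative deriv (deriv \<phi>) t) (at t)"
      "(deriv (deriv \<phi>) has_real_derivative deriv (deriv (deriv \<phi>)) t) (at t)"
      using smooth_on_deriv(1) \<phi>1 \<phi>2 by blast+
    show "deriv (deriv \<phi>) t \<le> 0" using H(4)[of t] by (simp add: numeral_2_eq_2)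
    show "0 \<le> deriv \<phi> t * deriv (deriv (deriv \<phi>)) t"
      using H(3)[of t] by (simp add: numeral_3_eq_3 mult.commute)
  qed (use H(5,7,9) M slopes in \<open>auto simp: properly_embedded_surface_def phi_minimal_def\<close>)
  show ?thesis by (rule plane)
qed

end
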